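(* For a positive measure $M$ on $\mathbb{R}$ with moments of all orders, let $A=A_M$ be the densely defined operator from $\ell^2=\ell^2(\mathbb{Z}_+)$ to $L^2(M)$ with domain $\mathcal{D}$ given by $Ag(x)=\sum_{n\ge 0} g_n x^n$ for $g=(g_0,g_1,\ldots)\in\mathcal{D}$. There exist determinate measures $M$ with unbounded support such that $A_M$ is closable. In particular, $A_M$ is closable for every determinate measure $M$ with finite index of determinacy.
   Context: $\ell^2=\ell^2(\mathbb{Z}_+)$ is the Hilbert space of square-summable complex sequences indexed by $n=0,1,2,\ldots$, and $\mathcal{D}\subset\ell^2$ is the dense subspace of complex sequences with only finitely many non-zero terms. $M$ has moments of all orders if $\mathbb{C}[x]\subset L^2(M)$; its moments are $q_n=\int_{-\infty}^\infty x^n\,dM(x)$, $n\ge 0$. $M$ is called determinate if it is the only positive measure on $\mathbb{R}$ with the moments $q_n$, $n\ge 0$, and indeterminate otherwise. An operator $A:\mathcal{D}\to L^2(M)$ is closable if whenever $g^{(n)}\in\mathcal{D}$, $g^{(n)}\to 0$ in $\ell^2$ and $Ag^{(n)}\to f$ in $L^2(M)$, then $f=0$. Index of determinacy: for a determinate measure $M$ and $z\in\mathbb{C}$, put $\mathrm{ind}_z(M)=\sup\{k\in\{0,1,2,\ldots\} : |x-z|^{2k}\,dM(x)\text{ is determinate}\}\in\{0,1,2,\ldots\}\cup\{\infty\}$. It is known that $\mathrm{ind}_z(M)$ is independent of $z\in\mathbb{C}\setminus\mathrm{supp}(M)$, and the common value is denoted $\mathrm{ind}(M)$, the index of determinacy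 of $M$. An indeterminate measure $N$ is called N-extremal if $\mathbb{C}[x]$ is dense in $L^2(N)$; such measures are discrete. It is known that the determinate measures with $\mathrm{ind}(M)=n<\infty$ are exactly the measures obtained from an N-extremal measure $N=\sum_{\lambda\in\Lambda}c_\lambda\delta_\lambda$ (all $c_\lambda>0$) by removing the masses at $n+1$ points of $\Lambda$. *)

theory Defs
  imports "HOL-Analysis.Analysis" "HOL-Library.Extended_Nat" "HOL-Computational_Algebra.Polynomial"
begin

text \<open>Elements of \<open>L\<^sup>2(M)\<close> are represented by functions, identified when they agree
  \<open>M\<close>-almost everywhere.\<close>

definition L2 :: "real measure \<Rightarrow> (real \<Rightarrow> complex) set" where
  "L2 M = {f \<in> borel_measurable M. integrable M (\<lambda>x. (cmod (f x))\<^sup>2)}"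

definition L2_norm :: "real measure \<Rightarrow> (real \<Rightarrow> complex) \<Rightarrow> real" where
  "L2_norm M f = sqrt (\<integral>x. (cmod (f x))\<^sup>2 \<partial>M)"

definition has_all_moments :: "real measure \<Rightarrow> bool" where
  "has_all_moments M \<longleftrightarrow>
     sets M = sets borel \<and> (\<forall>p :: complex poly. (\<lambda>x. poly p (complex_of_real x)) \<in> L2 M)"

definition moment :: "real measure \<Rightarrow> nat \<Rightarrow> real" where
  "moment M n = (\<integral>x. x ^ n \<partial>M)"

definition determinate :: "real measure \<Rightarrow> bool" where
  "determinate M \<longleftrightarrow>
     has_all_moments M \<and>
     (\<forall>N. has_all_moments N \<and> (\<forall>n. moment N n = moment M n) \<longrightarrow> N = M)"

definition supp :: "real measure \<Rightarrow> real set" where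
  "supp M = {x. \<forall>U. open U \<and> x \<in> U \<longrightarrow> emeasure M U > 0}"

definition ind_at :: "complex \<Rightarrow> real measure \<Rightarrow> enat" where
  "ind_at z M =
     Sup (enat ` {k. determinate (density M (\<lambda>x. ennreal (cmod (complex_of_real x - z) ^ (2 * k))))})"

text \<open>For determinate \<open>M\<close> the common value exists: if \<open>z\<close> and \<open>w\<close> lie outside the (closed) support,
  the densities \<open>|x - z|\<^sup>2\<^sup>k\<close> and \<open>|x - w|\<^sup>2\<^sup>k\<close> are bounded by constant multiples of each other on
  the support, and determinacy is inherited by measures with all moments dominated by a multiple
  of a determinate one.\<close>

definition index_of_determinacy :: "real measure \<Rightarrow> enat" where
  "index_of_determinacy M = (THE k. \<forall>z \<in> - (complex_of_real ` supp M). ind_at z M = k)"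

definition finite_seqs :: "(nat \<Rightarrow> complex) set" where
  "finite_seqs = {g. finite {n. g n \<noteq> 0}}"

definition ell2_norm :: "(nat \<Rightarrow> complex) \<Rightarrow> real" where
  "ell2_norm g = sqrt (\<Sum>n. (cmod (g n))\<^sup>2)"

text \<open>The operator \<open>A\<^sub>M\<close>; the formula does not involve \<open>M\<close>, which enters only through the
  target space \<open>L\<^sup>2(M)\<close>.\<close>

definition moment_op :: "(nat \<Rightarrow> complex) \<Rightarrow> real \<Rightarrow> complex" where
  "moment_op g x = (\<Sum>n | g n \<noteq> 0. g n * complex_of_real x ^ n)"

definition closable :: "real measure \<Rightarrow> ((nat \<Rightarrow> complex) \<Rightarrow> real \<Rightarrow> complex) \<Rightarrow> bool" where
  "closable M A \<longleftrightarrow>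
     (\<forall>g f. (\<forall>n. g n \<in> finite_seqs) \<and> f \<in> L2 M \<and>
        (\<lambda>n. ell2_norm (g n)) \<longlonglongrightarrow> 0 \<and>
        (\<lambda>n. L2_norm M (\<lambda>x. A (g n) x - f x)) \<longlonglongrightarrow> 0 \<longrightarrow>
        (AE x in M. f x = 0))"

end

theory Submission
  imports Defs "HOL-Complex_Analysis.Complex_Analysis" "HOL-Real_Asymp.Real_Asymp"
begin

text \<open>Let \<open>M \<noteq> N\<close> have the same moments and let \<open>w\<close> be the difference of their Cauchy transforms. For a
  polynomial \<open>p\<close> one has \<open>p(z) w(z) = \<integral> p(x) / (x - z) d(M - N)(x)\<close>, so \<open>p w\<close> is bounded by the
  \<open>L\<^sup>2\<close> norm of \<open>p\<close> on a line \<open>Im z = s\<close>; by reflection the same holds for \<open>p(z) w(z - 2is)\<close>, and by the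
  maximum principle this bound extends to the half-plane below, across the real axis. Polynomials that
  converge in \<open>L\<^sup>2(M)\<close> thus converge locally uniformly on the half-plane after multiplication with
  \<open>w(z - 2is)\<close>; if they tend to zero on the unit disc, as they do when their coefficients tend to zero
  in \<open>\<ell>\<^sup>2\<close>, they tend to zero at every real point. This settles indeterminate measures. If only
  \<open>|x - z|\<^sup>2\<^sup>k M\<close> is indeterminate, where \<open>|z| < 1\<close>, divide \<open>p - p(z)\<close> by \<open>x - z\<close> repeatedly.

  The existence claim is witnessed by the measure with masses \<open>4\<^bsup>-n(n+2)\<^esup>\<close> at the points \<open>4\<^sup>n\<close>: the
  evaluation at 0 is unbounded on polynomials, while after multiplication with \<open>|x - z|\<^sup>2\<close> all evaluations
  are locally bounded by Lagrange interpolation.\<close>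

section \<open>Square-integrable functions and moments\<close>

lemma L2_integrable_sq: "f \<in> L2 M \<Longrightarrow> integrable M (\<lambda>x. (cmod (f x))\<^sup>2)"
  by (simp add: L2_def)

lemma L2_measurable [measurable_dest]: "f \<in> L2 M \<Longrightarrow> f \<in> borel_measurable M"
  by (simp add: L2_def)

lemma cmod_add_sq_le: "(cmod (a + b))\<^sup>2 \<le> 2 * (cmod a)\<^sup>2 + 2 * (cmod b)\<^sup>2"
proof -
  have "(cmod (a + b))\<^sup>2 \<le> (cmod a + cmod b)\<^sup>2"
    by (intro power_mono norm_triangle_ineq) auto
  also have "\<dots> \<le> 2 * (cmod a)\<^sup>2 + 2 * (cmod b)\<^sup>2"
    using zero_le_power2[of "cmod a - cmod b"] by (simp add: power2_eq_square algebra_simps)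
  finally show ?thesis .
qed

lemma L2_add:
  assumes "f \<in> L2 M" "g \<in> L2 M"
  shows "(\<lambda>x. f x + g x) \<in> L2 M"
proof -
  have [measurable]: "f \<in> borel_measurable M" "g \<in> borel_measurable M"
    using assms by (auto simp: L2_def)
  have "integrable M (\<lambda>x. (cmod (f x + g x))\<^sup>2)"
  proof (rule Bochner_Integration.integrable_bound)
    show "integrable M (\<lambda>x. 2 * (cmod (f x))\<^sup>2 + 2 * (cmod (g x))\<^sup>2)"
      using assms by (auto simp: L2_def)
    show "AE x in M. norm ((cmod (f x + g x))\<^sup>2) \<le> norm (2 * (cmod (f x))\<^sup>2 + 2 * (cmod (g x))\<^sup>2)"
      by (intro AE_I2) (simp add: cmod_add_sq_le)
  qed measurable
  then show ?thesis by (simp add: L2_def)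
qed

lemma L2_uminus: "f \<in> L2 M \<Longrightarrow> (\<lambda>x. - f x) \<in> L2 M"
  by (simp add: L2_def)

lemma L2_diff: "f \<in> L2 M \<Longrightarrow> g \<in> L2 M \<Longrightarrow> (\<lambda>x. f x - g x) \<in> L2 M"
  using L2_add[of f M "\<lambda>x. - g x"] L2_uminus by simp

lemma L2_norm_nonneg [simp]: "L2_norm M f \<ge> 0"
  by (simp add: L2_norm_def)

lemma L2_norm_sq: "(L2_norm M f)\<^sup>2 = (\<integral>x. (cmod (f x))\<^sup>2 \<partial>M)"
  by (simp add: L2_norm_def)

lemma L2_norm_add_sq_le:
  assumes "f \<in> L2 M" "g \<in> L2 M"
  shows "(L2_norm M (\<lambda>x. f x + g x))\<^sup>2 \<le> 2 * (L2_norm M f)\<^sup>2 + 2 * (L2_norm M g)\<^sup>2"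
proof -
  have "(\<integral>x. (cmod (f x + g x))\<^sup>2 \<partial>M) \<le> (\<integral>x. 2 * (cmod (f x))\<^sup>2 + 2 * (cmod (g x))\<^sup>2 \<partial>M)"
    using assms L2_add[OF assms] by (intro integral_mono cmod_add_sq_le) (auto simp: L2_def)
  then show ?thesis
    using assms by (simp add: L2_norm_sq L2_def)
qed

lemma L2_integrable:
  assumes fin: "finite_measure M" and "f \<in> L2 M"
  shows "integrable M f"
proof -
  interpret finite_measure M by fact
  show ?thesis
  proof (rule Bochner_Integration.integrable_bound)
    show "integrable M (\<lambda>x. 1 + (cmod (f x))\<^sup>2)"
      using assms by (auto simp: L2_def)
    have "cmod (f x) \<le> 1 + (cmod (f x))\<^sup>2" for x
      using zero_le_power2[of "cmod (f x) - 1"] norm_ge_zero[of "f x"]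
      unfolding power2_diff one_power2 by linarith
    then show "AE x in M. norm (f x) \<le> norm (1 + (cmod (f x))\<^sup>2)"
      by (intro AE_I2) simp
  qed (use assms in \<open>auto simp: L2_def\<close>)
qed

text \<open>Cauchy-Schwarz against the constant 1, with total mass m: expanding the nonnegative
  integral of (m |f| - I)^2 gives m (m J - I^2) >= 0. Mass zero is separated because the last step
  cancels m.\<close>

lemma L1_le_L2_norm:
  assumes fin: "finite_measure M" and "f \<in> L2 M"
  shows "(\<integral>x. cmod (f x) \<partial>M) \<le> sqrt (measure M (space M)) * L2_norm M f"
proof -
  interpret finite_measure M by fact
  define m I J where "m = measure M (space M)" and "I = (\<integral>x. cmod (f x) \<partial>M)"
    and "J = (\<integral>x. (cmod (f x))\<^sup>2 \<partial>M)"
  have i1: "integrable M (\<lambda>x. cmod (f x))" and i2: "integrable M (\<lambda>x. (cmod (f x))\<^sup>2)"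
    using L2_integrable[OF assms] assms by (auto simp: L2_def)
  have "I\<^sup>2 \<le> m * J"
  proof (cases "m = 0")
    case True
    then have "emeasure M (space M) = 0"
      by (simp add: m_def emeasure_eq_measure)
    then have "AE x in M. False"
      by (intro AE_I[of _ _ "space M"]) auto
    then have "I = 0"
      unfolding I_def by (intro integral_eq_zero_AE) auto
    then show ?thesis using True by simp
  next
    case False
    then have m: "m > 0" by (simp add: m_def zero_less_measure_iff)
    have "0 \<le> (\<integral>x. (m * cmod (f x) - I)\<^sup>2 \<partial>M)" by simp
    also have "(\<lambda>x. (m * cmod (f x) - I)\<^sup>2) = (\<lambda>x. m\<^sup>2 * (cmod (f x))\<^sup>2 - 2 * m * I * cmod (f x) + I\<^sup>2)"
      by (auto simp: power2_eq_square algebra_simps)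
    also have "(\<integral>x. m\<^sup>2 * (cmod (f x))\<^sup>2 - 2 * m * I * cmod (f x) + I\<^sup>2 \<partial>M)
        = m\<^sup>2 * J - 2 * m * I * I + I\<^sup>2 * m"
      using i1 i2 by (simp add: I_def J_def m_def)
    also have "\<dots> = m * (m * J - I\<^sup>2)"
      by (simp add: power2_eq_square algebra_simps)
    finally show ?thesis using m by (simp add: zero_le_mult_iff)
  qed
  then have "I \<le> sqrt (m * J)"
    by (rule real_le_rsqrt)
  then show ?thesis
    by (simp add: I_def J_def m_def L2_norm_def real_sqrt_mult)
qed

text \<open>Convergent sequences are Cauchy. The squared inequality with factor 2 replaces the
  triangle inequality, and distances below e / 2 suffice because 2 (e/2)^2 + 2 (e/2)^2 =
  e^2.\<close>

lemma L2_norm_diff_limit_imp_small: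
  fixes q :: "nat \<Rightarrow> real \<Rightarrow> complex"
  assumes q: "\<And>n. q n \<in> L2 M" and h: "h \<in> L2 M"
    and lim: "(\<lambda>n. L2_norm M (\<lambda>x. q n x - h x)) \<longlonglongrightarrow> 0" and "e > 0"
  shows "\<exists>K. \<forall>m\<ge>K. \<forall>n\<ge>K. L2_norm M (\<lambda>x. q m x - q n x) < e"
proof -
  define d where "d n = L2_norm M (\<lambda>x. q n x - h x)" for n
  have "\<forall>\<^sub>F n in sequentially. d n < e / 2"
    using lim \<open>e > 0\<close> by (intro order_tendstoD(2)[of _ 0]) (auto simp: d_def)
  then obtain K where K: "\<And>n. n \<ge> K \<Longrightarrow> d n < e / 2"
    by (auto simp: eventually_sequentially)
  have "L2_norm M (\<lambda>x. q m x - q n x) < e" if "m \<ge> K" "n \<ge> K" for m n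
  proof -
    have "(L2_norm M (\<lambda>x. (q m x - h x) + (- (q n x - h x))))\<^sup>2
        \<le> 2 * (L2_norm M (\<lambda>x. q m x - h x))\<^sup>2 + 2 * (L2_norm M (\<lambda>x. - (q n x - h x)))\<^sup>2"
      by (intro L2_norm_add_sq_le L2_uminus L2_diff q h)
    also have "L2_norm M (\<lambda>x. - (q n x - h x)) = d n"
      by (simp add: d_def L2_norm_def norm_minus_commute)
    also have "L2_norm M (\<lambda>x. q m x - h x) = d m"
      by (simp add: d_def)
    also have "2 * (d m)\<^sup>2 + 2 * (d n)\<^sup>2 < 2 * (e/2)\<^sup>2 + 2 * (e/2)\<^sup>2"
      using K that by (intro add_strict_mono mult_strict_left_mono power_strict_mono) (auto simp: d_def)
    also have "\<dots> = e\<^sup>2" by (simp add: power2_eq_square)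
    finally show ?thesis
      using \<open>e > 0\<close> by (simp add: power2_less_imp_less)
  qed
  then show ?thesis by blast
qed

text \<open>Fatou's lemma identifies the two limits without passing to a subsequence: |q n - h|^2
  tends to |h|^2 almost everywhere, while its integrals tend to 0.\<close>

lemma L2_limit_zero_AE:
  assumes q: "\<And>n. q n \<in> L2 M" and h: "h \<in> L2 M"
    and lim: "(\<lambda>n. L2_norm M (\<lambda>x. q n x - h x)) \<longlonglongrightarrow> 0"
    and pt: "AE x in M. (\<lambda>n. q n x) \<longlonglongrightarrow> 0"
  shows "AE x in M. h x = 0"
proof -
  have [measurable]: "\<And>n. q n \<in> borel_measurable M" "h \<in> borel_measurable M"
    using q h by (auto simp: L2_def)
  have nn: "(\<integral>\<^sup>+x. ennreal ((cmod (q n x - h x))\<^sup>2) \<partial>M) = ennreal ((L2_norm M (\<lambda>x. q n x - h x))\<^sup>2)" for n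
    unfolding L2_norm_sq using L2_integrable_sq[OF L2_diff[OF q h]]
    by (intro nn_integral_eq_integral) auto
  have "(\<lambda>n. ennreal ((L2_norm M (\<lambda>x. q n x - h x))\<^sup>2)) \<longlonglongrightarrow> ennreal (0\<^sup>2)"
    by (intro tendsto_ennrealI tendsto_power lim)
  then have lim2: "liminf (\<lambda>n. \<integral>\<^sup>+x. ennreal ((cmod (q n x - h x))\<^sup>2) \<partial>M) = 0"
    unfolding nn by (simp add: lim_imp_Liminf)
  have "(\<integral>\<^sup>+x. ennreal ((cmod (h x))\<^sup>2) \<partial>M) = (\<integral>\<^sup>+x. liminf (\<lambda>n. ennreal ((cmod (q n x - h x))\<^sup>2)) \<partial>M)"
  proof (rule nn_integral_cong_AE, use pt in eventually_elim)
    fix x assume "(\<lambda>n. q n x) \<longlonglongrightarrow> 0"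
    then have "(\<lambda>n. ennreal ((cmod (q n x - h x))\<^sup>2)) \<longlonglongrightarrow> ennreal ((cmod (0 - h x))\<^sup>2)"
      by (intro tendsto_ennrealI tendsto_power tendsto_norm tendsto_diff tendsto_const)
    from lim_imp_Liminf[OF _ this]
    show "ennreal ((cmod (h x))\<^sup>2) = liminf (\<lambda>n. ennreal ((cmod (q n x - h x))\<^sup>2))"
      by simp
  qed
  also have "\<dots> \<le> liminf (\<lambda>n. \<integral>\<^sup>+x. ennreal ((cmod (q n x - h x))\<^sup>2) \<partial>M)"
    by (intro nn_integral_liminf) measurable
  finally have "(\<integral>\<^sup>+x. ennreal ((cmod (h x))\<^sup>2) \<partial>M) = 0"
    by (simp add: lim2)
  then show ?thesis
    by (subst (asm) nn_integral_0_iff_AE) auto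
qed

section \<open>Polynomials in \<open>L2 M\<close> and the quantities that the moments
  determine\<close>

abbreviation rpoly :: "complex poly \<Rightarrow> real \<Rightarrow> complex" where
  "rpoly p x \<equiv> poly p (complex_of_real x)"

lemma borel_measurable_rpoly [measurable]: "rpoly p \<in> borel_measurable borel"
  by (intro borel_measurable_continuous_onI continuous_intros)

lemma has_all_moments_sets: "has_all_moments M \<Longrightarrow> sets M = sets borel"
  by (simp add: has_all_moments_def)

lemma has_all_moments_L2: "has_all_moments M \<Longrightarrow> rpoly p \<in> L2 M"
  by (simp add: has_all_moments_def)

lemma has_all_moments_finite: 
  assumes "has_all_moments M"
  shows "finite_measure M"
proof (rule finite_measureI)
  have "integrable M (\<lambda>x. 1 :: real)"
    using L2_integrable_sq[OF has_all_moments_L2[OF assms, of 1]] by simp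
  then show "emeasure M (space M) \<noteq> \<infinity>"
    unfolding integrable_iff_bounded by auto
qed

lemma has_all_moments_integrable: "has_all_moments M \<Longrightarrow> integrable M (rpoly p)"
  using L2_integrable has_all_moments_L2 has_all_moments_finite by blast

lemma has_all_moments_integrable_power:
  assumes "has_all_moments M"
  shows "integrable M (\<lambda>x. x ^ n)"
proof -
  have "integrable M (\<lambda>x. Re (rpoly (monom 1 n) x))"
    using has_all_moments_integrable[OF assms] by (rule integrable_Re)
  then show ?thesis by (simp add: poly_monom flip: of_real_power)
qed

lemma integral_rpoly:
  assumes "has_all_moments M"
  shows "(\<integral>x. rpoly p x \<partial>M) = (\<Sum>k\<le>degree p. coeff p k * of_real (moment M k))"
proof -
  have *: "integrable M (\<lambda>x. complex_of_real x ^ k)" for k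
    using has_all_moments_integrable[OF assms, of "monom 1 k"] by (simp add: poly_monom)
  have **: "(\<integral>x. complex_of_real x ^ k \<partial>M) = of_real (moment M k)" for k
    unfolding moment_def by (simp flip: of_real_power)
  have "(\<integral>x. rpoly p x \<partial>M) = (\<Sum>k\<le>degree p. \<integral>x. coeff p k * complex_of_real x ^ k \<partial>M)"
    unfolding poly_altdef using * by (intro Bochner_Integration.integral_sum) auto
  then show ?thesis by (simp add: **)
qed

definition same_moments :: "real measure \<Rightarrow> real measure \<Rightarrow> bool" where
  "same_moments M N \<longleftrightarrow> has_all_moments M \<and> has_all_moments N \<and> (\<forall>n. moment M n = moment N n)"

lemma same_moments_integral_rpoly:
  "same_moments M N \<Longrightarrow> (\<integral>x. rpoly p x \<partial>M) = (\<integral>x. rpoly p x \<partial>N)"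
  by (simp add: same_moments_def integral_rpoly)

text \<open>On the real line the squared modulus of a polynomial is again a polynomial. Therefore
  measures with the same moments give every polynomial the same \<open>L2_norm\<close>.\<close>

lemma rpoly_mult_cnj: "complex_of_real ((cmod (rpoly p x))\<^sup>2) = rpoly (p * map_poly cnj p) x"
proof -
  have "rpoly (map_poly cnj p) x = cnj (rpoly p x)"
    using poly_cnj[of p "complex_of_real x"] by simp
  then show ?thesis by (simp only: complex_norm_square poly_mult)
qed

lemma same_moments_L2_norm:
  assumes "same_moments M N"
  shows "L2_norm M (rpoly p) = L2_norm N (rpoly p)"
proof -
  have "complex_of_real (\<integral>x. (cmod (rpoly p x))\<^sup>2 \<partial>M) = of_real (\<integral>x. (cmod (rpoly p x))\<^sup>2 \<partial>N)"
    using same_moments_integral_rpoly[OF assms, of "p * map_poly cnj p"]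
    unfolding rpoly_mult_cnj[symmetric] integral_complex_of_real .
  then show ?thesis by (simp only: L2_norm_def of_real_eq_iff)
qed

lemma same_moments_measure:
  assumes "same_moments M N"
  shows "measure M (space M) = measure N (space N)"
  using same_moments_integral_rpoly[OF assms, of 1]
  by (simp add: of_real_eq_iff)

section \<open>Cauchy transforms\<close>

text \<open>The Stieltjes transform. On the real axis the integrand may fail to be integrable and
  the integral then takes a default value, so the transform is evaluated below only where Im z is
  nonzero.\<close>

definition cauchy_transform :: "real measure \<Rightarrow> complex \<Rightarrow> complex" where
  "cauchy_transform M z = (\<integral>x. 1 / (complex_of_real x - z) \<partial>M)"

lemma abs_Im_le_cmod_diff: "\<bar>Im z\<bar> \<le> cmod (complex_of_real x - z)"
  using abs_Im_le_cmod[of "complex_of_real x - z"] by simp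

lemma norm_div_of_real_diff_le:
  assumes "Im z \<noteq> 0"
  shows "cmod (a / (complex_of_real x - z)) \<le> cmod a / \<bar>Im z\<bar>"
proof -
  have "\<bar>Im z\<bar> > 0" using assms by simp
  then show ?thesis
    unfolding norm_divide using abs_Im_le_cmod_diff[of z x]
    by (intro divide_left_mono mult_pos_pos) auto
qed

lemma integrable_div_of_real_diff:
  assumes [measurable_cong]: "sets M = sets borel" and f: "integrable M f" and z: "Im z \<noteq> 0"
  shows "integrable M (\<lambda>x. f x / (complex_of_real x - z))"
proof (rule Bochner_Integration.integrable_bound)
  show "integrable M (\<lambda>x. cmod (f x) / \<bar>Im z\<bar>)"
    using f by auto
  show "AE x in M. norm (f x / (complex_of_real x - z)) \<le> norm (cmod (f x) / \<bar>Im z\<bar>)"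
    using norm_div_of_real_diff_le[OF z] by (intro AE_I2) simp
  have [measurable]: "f \<in> borel_measurable M" using f by simp
  show "(\<lambda>x. f x / (complex_of_real x - z)) \<in> borel_measurable M"
    by measurable
qed

lemma cmod_integral_div_of_real_diff_le:
  assumes "finite_measure M" and sets: "sets M = sets borel" and f: "f \<in> L2 M" and z: "Im z \<noteq> 0"
  shows "cmod (\<integral>x. f x / (complex_of_real x - z) \<partial>M) \<le> sqrt (measure M (space M)) * L2_norm M f / \<bar>Im z\<bar>"
proof -
  note int = L2_integrable[OF assms(1) f]
  have "cmod (\<integral>x. f x / (complex_of_real x - z) \<partial>M) \<le> (\<integral>x. cmod (f x / (complex_of_real x - z)) \<partial>M)"
    by (rule integral_norm_bound)
  also have "\<dots> \<le> (\<integral>x. cmod (f x) / \<bar>Im z\<bar> \<partial>M)"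
    using int integrable_div_of_real_diff[OF sets int z]
    by (intro integral_mono norm_div_of_real_diff_le z) auto
  also have "\<dots> = (\<integral>x. cmod (f x) \<partial>M) / \<bar>Im z\<bar>" by simp
  also have "\<dots> \<le> sqrt (measure M (space M)) * L2_norm M f / \<bar>Im z\<bar>"
    by (intro divide_right_mono L1_le_L2_norm assms) auto
  finally show ?thesis .
qed

text \<open>The quotient p(x) / (x - z) splits into (p(x) - p(z)) / (x - z), a polynomial in x whose
  integral depends on the moments only, and p(z) / (x - z), which produces the Cauchy
  transform.\<close>

lemma integral_rpoly_div:
  assumes M: "has_all_moments M" and z: "Im z \<noteq> 0"
  shows "(\<integral>x. rpoly p x / (complex_of_real x - z) \<partial>M)
    = (\<integral>x. rpoly (synthetic_div p z) x \<partial>M) + poly p z * cauchy_transform M z"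
proof -
  interpret finite_measure M by (rule has_all_moments_finite[OF M])
  have "rpoly p x / (complex_of_real x - z) = rpoly (synthetic_div p z) x + poly p z * (1 / (complex_of_real x - z))" for x
  proof -
    have "complex_of_real x - z \<noteq> 0" using z by auto
    moreover have "rpoly p x = (complex_of_real x - z) * rpoly (synthetic_div p z) x + poly p z"
      by (subst synthetic_div_correct'[of z p, symmetric]) (simp add: algebra_simps)
    ultimately show ?thesis by (simp add: field_simps)
  qed
  moreover have "integrable M (\<lambda>x. 1 / (complex_of_real x - z))"
    by (rule integrable_div_of_real_diff[OF has_all_moments_sets[OF M] _ z]) simp
  ultimately have "(\<integral>x. rpoly p x / (complex_of_real x - z) \<partial>M)
    = (\<integral>x. rpoly (synthetic_div p z) x \<partial>M) + (\<integral>x. poly p z * (1 / (complex_of_real x - z)) \<partial>M)"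
    by (simp only:) (intro Bochner_Integration.integral_add has_all_moments_integrable[OF M] integrable_mult_right)
  then show ?thesis
    by (simp only: cauchy_transform_def integral_mult_right_zero)
qed

text \<open>The polynomial \<open>(p(x) - p(z)) / (x - z)\<close> has the same integral for both measures.\<close>

lemma poly_mult_cauchy_transform_diff_le:
  assumes MN: "same_moments M N" and z: "Im z \<noteq> 0"
  shows "cmod (poly p z * (cauchy_transform M z - cauchy_transform N z))
    \<le> 2 * sqrt (measure M (space M)) * L2_norm M (rpoly p) / \<bar>Im z\<bar>"
proof -
  have M: "has_all_moments M" and N: "has_all_moments N"
    using MN by (auto simp: same_moments_def)
  have eq: "poly p z * (cauchy_transform M z - cauchy_transform N z)
    = (\<integral>x. rpoly p x / (complex_of_real x - z) \<partial>M) - (\<integral>x. rpoly p x / (complex_of_real x - z) \<partial>N)"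
    using same_moments_integral_rpoly[OF MN, of "synthetic_div p z"]
    unfolding integral_rpoly_div[OF M z] integral_rpoly_div[OF N z] by (simp add: algebra_simps)
  have "cmod (poly p z * (cauchy_transform M z - cauchy_transform N z)) \<le> cmod (\<integral>x. rpoly p x / (complex_of_real x - z) \<partial>M) + cmod (\<integral>x. rpoly p x / (complex_of_real x - z) \<partial>N)"
    unfolding eq by (rule norm_triangle_ineq4)
  also have "\<dots> \<le> sqrt (measure M (space M)) * L2_norm M (rpoly p) / \<bar>Im z\<bar> 
      + sqrt (measure N (space N)) * L2_norm N (rpoly p) / \<bar>Im z\<bar>"
    using M N z by (intro add_mono cmod_integral_div_of_real_diff_le has_all_moments_finite
        has_all_moments_sets has_all_moments_L2) auto
  finally show ?thesis
    by (simp add: same_moments_measure[OF MN] same_moments_L2_norm[OF MN])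
qed

lemma cauchy_transform_cnj:
  assumes "finite_measure M" "sets M = sets borel" "Im z \<noteq> 0"
  shows "cauchy_transform M (cnj z) = cnj (cauchy_transform M z)"
proof -
  interpret finite_measure M by fact
  have "integrable M (\<lambda>x. 1 / (complex_of_real x - z))"
    by (rule integrable_div_of_real_diff) (use assms in auto)
  then have "(\<integral>x. cnj (1 / (complex_of_real x - z)) \<partial>M) = cnj (\<integral>x. 1 / (complex_of_real x - z) \<partial>M)"
    by (rule integral_bounded_linear[OF bounded_linear_cnj])
  then show ?thesis
    by (simp add: cauchy_transform_def)
qed

text \<open>Controls the remainder of the difference quotient of the Cauchy transform: there a = |x
  - (z + h)|, b = |x - z| and c = |h|.\<close>

lemma divide_mult_sq_le:
  fixes a b c \<eta> :: real
  assumes "0 < \<eta>" "\<eta> / 2 \<le> a" "\<eta> \<le> b" "0 \<le> c"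
  shows "c / (a * b\<^sup>2) \<le> c * (2 / \<eta> ^ 3)"
proof -
  have "\<eta> / 2 * \<eta>\<^sup>2 \<le> a * b\<^sup>2"
    using assms by (intro mult_mono power_mono) auto
  moreover have "\<eta> / 2 * \<eta>\<^sup>2 > 0" using assms by simp
  ultimately have "c / (a * b\<^sup>2) \<le> c / (\<eta> / 2 * \<eta>\<^sup>2)"
    using assms by (intro divide_left_mono mult_pos_pos) auto
  also have "\<dots> = c * (2 / \<eta> ^ 3)"
    by (simp add: power2_eq_square power3_eq_cube)
  finally show ?thesis .
qed

text \<open>Differentiation under the integral: the difference quotient of the integrand minus its
  derivative is exactly h / ((x - z - h) (x - z)^2), which is of order h uniformly in x.\<close>

lemma cauchy_transform_has_field_derivative:
  assumes fin: "finite_measure M" and sets: "sets M = sets borel" and z: "Im z \<noteq> 0"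
  shows "(cauchy_transform M has_field_derivative (\<integral>x. 1 / (complex_of_real x - z)\<^sup>2 \<partial>M)) (at z)"
proof -
  interpret finite_measure M by fact
  define \<eta> where "\<eta> = \<bar>Im z\<bar>"
  have \<eta>: "\<eta> > 0" using z by (simp add: \<eta>_def)
  define D where "D = (\<integral>x. 1 / (complex_of_real x - z)\<^sup>2 \<partial>M)"
  define K where "K = 2 / \<eta> ^ 3 * measure M (space M)"
  have i1: "integrable M (\<lambda>x. 1 / (complex_of_real x - z))" if "Im z \<noteq> 0" for z
    by (rule integrable_div_of_real_diff[OF sets _ that]) simp
  have i2: "integrable M (\<lambda>x. 1 / (complex_of_real x - z)\<^sup>2)"
    using integrable_div_of_real_diff[OF sets i1[OF z] z] by (simp add: power2_eq_square)
  have bound: "cmod ((cauchy_transform M (z + h) - cauchy_transform M z) / h - D) \<le> cmod h * K"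
    if h: "h \<noteq> 0" "cmod h < \<eta> / 2" for h
  proof -
    \<comment> \<open>An increment shorter than half the height of z keeps z + h away from the real
      axis.\<close>
    have Im: "\<bar>Im (z + h)\<bar> \<ge> \<eta> / 2"
      using abs_Im_le_cmod[of h] h unfolding \<eta>_def plus_complex.sel by linarith
    then have zh: "Im (z + h) \<noteq> 0" using \<eta> by auto
    have pt: "(1 / (complex_of_real x - (z + h)) - 1 / (complex_of_real x - z)) / h - 1 / (complex_of_real x - z)\<^sup>2
        = h / ((complex_of_real x - (z + h)) * (complex_of_real x - z)\<^sup>2)" for x
    proof -
      define a where "a = complex_of_real x - z"
      have "a \<noteq> 0" "a - h \<noteq> 0"
        using z zh by (auto simp: a_def complex_eq_iff)
      moreover have "complex_of_real x - (z + h) = a - h" by (simp add: a_def)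
      ultimately show ?thesis
        using h(1) unfolding a_def[symmetric] by (simp add: field_simps power2_eq_square)
    qed
    have quot: "(cauchy_transform M (z + h) - cauchy_transform M z) / h - D
      = (\<integral>x. (1 / (complex_of_real x - (z + h)) - 1 / (complex_of_real x - z)) / h - 1 / (complex_of_real x - z)\<^sup>2 \<partial>M)"
      unfolding cauchy_transform_def D_def using i1[OF z] i1[OF zh] i2
      by simp
    have "cmod ((cauchy_transform M (z + h) - cauchy_transform M z) / h - D)
      \<le> (\<integral>x. cmod ((1 / (complex_of_real x - (z + h)) - 1 / (complex_of_real x - z)) / h - 1 / (complex_of_real x - z)\<^sup>2) \<partial>M)"
      unfolding quot by (rule integral_norm_bound)
    also have "\<dots> \<le> (\<integral>x. cmod h * (2 / \<eta> ^ 3) \<partial>M)"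
    proof (rule integral_mono)
      fix x
      have "cmod h / (cmod (complex_of_real x - (z + h)) * (cmod (complex_of_real x - z))\<^sup>2) \<le> cmod h * (2 / \<eta> ^ 3)"
      proof (rule divide_mult_sq_le)
        show "\<eta> / 2 \<le> cmod (complex_of_real x - (z + h))"
          using Im abs_Im_le_cmod_diff by (rule order_trans)
        show "\<eta> \<le> cmod (complex_of_real x - z)"
          unfolding \<eta>_def by (rule abs_Im_le_cmod_diff)
      qed (use \<eta> in auto)
      then show "cmod ((1 / (complex_of_real x - (z + h)) - 1 / (complex_of_real x - z)) / h - 1 / (complex_of_real x - z)\<^sup>2) \<le> cmod h * (2 / \<eta> ^ 3)"
        unfolding pt by (simp add: norm_divide norm_mult norm_power)
    qed (use i1[OF z] i1[OF zh] i2 in auto)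
    also have "\<dots> = cmod h * K" by (simp add: K_def)
    finally show ?thesis .
  qed
  have "(\<lambda>h. (cauchy_transform M (z + h) - cauchy_transform M z) / h - D) \<midarrow>0\<rightarrow> 0"
  proof (rule Lim_null_comparison)
    show "\<forall>\<^sub>F h in at 0. norm ((cauchy_transform M (z + h) - cauchy_transform M z) / h - D) \<le> cmod h * K"
      unfolding eventually_at using bound \<eta> by (intro exI[of _ "\<eta> / 2"]) auto
    show "(\<lambda>h. cmod h * K) \<midarrow>0\<rightarrow> 0"
      by (auto intro!: tendsto_eq_intros)
  qed
  then show ?thesis
    unfolding DERIV_def D_def[symmetric] by (simp add: LIM_zero_iff)
qed

lemma cauchy_transform_holomorphic_on:
  assumes "finite_measure M" "sets M = sets borel" "\<And>z. z \<in> S \<Longrightarrow> Im z \<noteq> 0"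
  shows "cauchy_transform M holomorphic_on S"
  using cauchy_transform_has_field_derivative[OF assms(1,2)] assms(3)
  unfolding holomorphic_on_def field_differentiable_def
  by (meson has_field_derivative_at_within)

text \<open>A simple case of the Phragmen-Lindelof principle: the decay expressed by
  \<open>K\<close> makes f at most e on a large arc about c, and the maximum principle on the part
  of the half-plane inside that disc gives the bound B + e. Holomorphy up to r > s supplies
  continuity on the boundary line.\<close>

lemma halfplane_maximum_modulus:
  assumes hol: "f holomorphic_on {z. Im z < r}" and "s < r"
    and B: "\<And>z. Im z = s \<Longrightarrow> cmod (f z) \<le> B"
    and K: "\<And>z. Im z \<le> s \<Longrightarrow> cmod (f z) * cmod (z - c) \<le> K"
    and z: "Im z \<le> s"
  shows "cmod (f z) \<le> B"
proof -
  have B0: "B \<ge> 0" using order_trans[OF norm_ge_zero B[of "Complex 0 s"]] by simp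
  have "cmod (f z) \<le> B + e" if "e > 0" for e
  proof -
    \<comment> \<open>This radius makes |K| / R at most e on the arc and puts z into the disc; the
      summand 1 keeps it positive.\<close>
    define R where "R = max (\<bar>K\<bar> / e) (cmod (z - c)) + 1"
    define S where "S = {z. Im z \<le> s} \<inter> cball c R"
    have R: "R > 0" "R \<ge> \<bar>K\<bar> / e" "cmod (z - c) \<le> R" 
      unfolding R_def using norm_ge_zero[of "z - c"] by linarith+
    have "closed S" unfolding S_def by (intro closed_Int closed_halfspace_Im_le closed_cball)
    have sub: "S \<subseteq> {z. Im z < r}" using \<open>s < r\<close> by (auto simp: S_def)
    show ?thesis
    proof (rule maximum_modulus_frontier[of f S])
      show "f holomorphic_on interior S"
        using hol sub interior_subset[of S] by (meson holomorphic_on_subset order_trans)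
      show "continuous_on (closure S) f"
        using hol sub \<open>closed S\<close> by (simp add: closure_closed) (meson holomorphic_on_imp_continuous_on holomorphic_on_subset)
      show "bounded S" unfolding S_def by (intro bounded_Int disjI2 bounded_cball)
      show "z \<in> S" using z R by (auto simp: S_def dist_norm norm_minus_commute)
      fix y assume "y \<in> frontier S"
      then have y: "y \<in> S" "y \<notin> interior S"
        using \<open>closed S\<close> by (auto simp: frontier_def)
      have "\<not> (Im y < s \<and> dist c y < R)"
      proof
        assume "Im y < s \<and> dist c y < R"
        then have "y \<in> {z. Im z < s} \<inter> ball c R" by auto
        moreover have "{z. Im z < s} \<inter> ball c R \<subseteq> interior S"
          unfolding S_def by (intro interior_maximal open_Int open_halfspace_Im_lt) auto
        ultimately show False using y(2) by auto
      qed
      then consider "Im y = s" | "cmod (y - c) = R" "Im y \<le> s"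
        using y(1) by (force simp: S_def dist_norm norm_minus_commute)
      then show "norm (f y) \<le> B + e"
      proof cases
        case 1
        then show ?thesis using B[of y] that by simp
      next
        case 2
        then have "cmod (f y) * R \<le> \<bar>K\<bar>" using K[of y] by simp
        also have "\<dots> \<le> e * R" using R(2) that by (simp add: field_simps)
        finally show ?thesis using R(1) B0 by simp
      qed
    qed
  qed
  then show ?thesis by (rule field_le_epsilon)
qed

text \<open>On the line \<open>Im z = s\<close> the function \<open>w\<close> and its translate \<open>w(z - 2is)\<close> have the same modulus,
  because \<open>w(cnj z) = cnj (w z)\<close>; unlike \<open>w\<close>, the translate is holomorphic across the real axis.\<close>

lemma poly_mult_shifted_cauchy_transform_le:
  fixes M N :: "real measure" and s :: real
  defines "w \<equiv> \<lambda>z. cauchy_transform M z - cauchy_transform N z"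
  assumes MN: "same_moments M N" and s: "s > 0" and z: "Im z \<le> s"
  shows "cmod (poly p z * w (z - 2 * s * \<i>))
    \<le> 2 * sqrt (measure M (space M)) * L2_norm M (rpoly p) / s"
proof (rule halfplane_maximum_modulus[of "\<lambda>z. poly p z * w (z - 2 * s * \<i>)" "2 * s" s, where c = "2 * s * \<i>"])
  have M: "has_all_moments M" and N: "has_all_moments N"
    using MN by (auto simp: same_moments_def)
  have fin: "finite_measure M" "sets M = sets borel" "finite_measure N" "sets N = sets borel"
    using M N by (auto simp: has_all_moments_finite has_all_moments_sets)
  have "w holomorphic_on (\<lambda>z. z - 2 * s * \<i>) ` {z. Im z < 2 * s}"
    unfolding w_def using fin by (intro holomorphic_intros cauchy_transform_holomorphic_on) auto
  moreover have "(\<lambda>z. z - 2 * s * \<i>) holomorphic_on {z. Im z < 2 * s}"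
    by (intro holomorphic_intros)
  ultimately have "(\<lambda>z. w (z - 2 * s * \<i>)) holomorphic_on {z. Im z < 2 * s}"
    using holomorphic_on_compose[of "\<lambda>z. z - 2 * s * \<i>" "{z. Im z < 2 * s}" w]
    by (simp add: o_def)
  then show "(\<lambda>z. poly p z * w (z - 2 * s * \<i>)) holomorphic_on {z. Im z < 2 * s}"
    by (intro holomorphic_on_mult holomorphic_intros)
  fix y :: complex
  show "cmod (poly p y * w (y - 2 * s * \<i>))
    \<le> 2 * sqrt (measure M (space M)) * L2_norm M (rpoly p) / s" if y: "Im y = s"
  proof -
    have "y - 2 * s * \<i> = cnj y" using y by (simp add: complex_eq_iff)
    then have "cmod (w (y - 2 * s * \<i>)) = cmod (w y)"
      unfolding w_def using fin y s by (simp add: cauchy_transform_cnj flip: complex_cnj_diff)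
    then show ?thesis
      using poly_mult_cauchy_transform_diff_le[OF MN, of y p] y s by (simp add: w_def norm_mult)
  qed
  \<comment> \<open>With u = y - 2is one has r(u) = p(u + 2is) u. The extra factor u turns the bound
    for r on the line or below into decay of p w like 1 / |u|, as the maximum principle
    demands.\<close>
  define r where "r = pcompose p [:2 * s * \<i>, 1:] * [:0, 1:]"
  show "cmod (poly p y * w (y - 2 * s * \<i>)) * cmod (y - 2 * s * \<i>)
    \<le> 2 * sqrt (measure M (space M)) * L2_norm M (rpoly r) / s" if y: "Im y \<le> s"
  proof -
    define u where "u = y - 2 * s * \<i>"
    have u: "Im u \<le> - s" using y by (simp add: u_def)
    have "poly p y * (y - 2 * s * \<i>) = poly r u"
      by (simp add: r_def u_def poly_pcompose)
    then have "poly p y * w (y - 2 * s * \<i>) * (y - 2 * s * \<i>) = poly r u * w u"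
      by (simp add: u_def)
    then have "cmod (poly p y * w (y - 2 * s * \<i>)) * cmod (y - 2 * s * \<i>) = cmod (poly r u * w u)"
      by (simp flip: norm_mult)
    also have "\<dots> \<le> 2 * sqrt (measure M (space M)) * L2_norm M (rpoly r) / \<bar>Im u\<bar>"
      unfolding w_def using u s by (intro poly_mult_cauchy_transform_diff_le[OF MN]) auto
    also have "\<dots> \<le> 2 * sqrt (measure M (space M)) * L2_norm M (rpoly r) / s"
      using u s by (intro divide_left_mono mult_nonneg_nonneg mult_pos_pos) auto
    finally show ?thesis .
  qed
qed (use s z in auto)

section \<open>Stieltjes inversion and injectivity of the Cauchy transform\<close>

lemma poisson_integral_eq_cauchy_transform:
  assumes fin: "finite_measure M" and sets: "sets M = sets borel" and y: "y > 0"
  shows "(\<integral>\<^sup>+x. ennreal (y / ((x - t)\<^sup>2 + y\<^sup>2)) \<partial>M) = ennreal (- Im (cauchy_transform M (Complex t (- y))))"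
proof -
  interpret finite_measure M by fact
  have "integrable M (\<lambda>x. 1 / (complex_of_real x - Complex t (- y)))"
    using y by (intro integrable_div_of_real_diff[OF sets]) auto
  then have i: "integrable M (\<lambda>x. - Im (1 / (complex_of_real x - Complex t (- y))))"
    and e: "- Im (cauchy_transform M (Complex t (- y))) = (\<integral>x. - Im (1 / (complex_of_real x - Complex t (- y))) \<partial>M)"
    unfolding cauchy_transform_def by (auto simp: integral_Im)
  have pt: "- Im (1 / (complex_of_real x - Complex t (- y))) = y / ((x - t)\<^sup>2 + y\<^sup>2)" for x
    by (simp add: Im_divide)
  show ?thesis
    using i y unfolding e pt by (intro nn_integral_eq_integral) auto
qed

lemma nn_integral_poisson_kernel:
  assumes "y > 0" "a \<le> b"
  shows "(\<integral>\<^sup>+t. ennreal (y / ((x - t)\<^sup>2 + y\<^sup>2)) * indicator {a..b} t \<partial>lborel)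
    = ennreal (arctan ((b - x) / y) - arctan ((a - x) / y))"
proof (rule nn_integral_FTC_Icc)
  fix t :: real
  have "1 / (1 + ((t - x) / y)\<^sup>2) * (1 / y) = y / ((x - t)\<^sup>2 + y\<^sup>2)"
    using assms by (simp add: power_divide power2_commute[of t x] divide_simps) (simp add: power2_eq_square algebra_simps)
  then show "DERIV (\<lambda>t. arctan ((t - x) / y)) t :> y / ((x - t)\<^sup>2 + y\<^sup>2)"
    using assms by (auto intro!: derivative_eq_intros simp: inverse_eq_divide)
qed (use assms in auto)

text \<open>The Poisson integral of a measure at height y is read off from its Cauchy transform.
  Integrating it over t in [a, b] and exchanging the integrals leaves the arctangent differences,
  which are therefore determined as well.\<close>

lemma cauchy_transform_eq_imp_arctan_integral_eq:
  assumes M: "finite_measure M" "sets M = sets borel" and N: "finite_measure N" "sets N = sets borel"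
    and eq: "\<And>z. Im z < 0 \<Longrightarrow> cauchy_transform M z = cauchy_transform N z"
    and y: "y > 0" and ab: "a \<le> b"
  shows "(\<integral>\<^sup>+x. ennreal (arctan ((b - x) / y) - arctan ((a - x) / y)) \<partial>M)
    = (\<integral>\<^sup>+x. ennreal (arctan ((b - x) / y) - arctan ((a - x) / y)) \<partial>N)"
proof -
  have *: "(\<integral>\<^sup>+x. ennreal (arctan ((b - x) / y) - arctan ((a - x) / y)) \<partial>L)
      = (\<integral>\<^sup>+t. ennreal (- Im (cauchy_transform L (Complex t (- y)))) * indicator {a..b} t \<partial>lborel)"
    if L: "finite_measure L" and sets [measurable_cong]: "sets L = sets borel" for L :: "real measure"
  proof -
    interpret L: finite_measure L by fact
    interpret pair_sigma_finite lborel L ..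
    have "(\<integral>\<^sup>+x. ennreal (arctan ((b - x) / y) - arctan ((a - x) / y)) \<partial>L)
      = (\<integral>\<^sup>+x. (\<integral>\<^sup>+t. ennreal (y / ((x - t)\<^sup>2 + y\<^sup>2)) * indicator {a..b} t \<partial>lborel) \<partial>L)"
      by (simp add: nn_integral_poisson_kernel y ab)
    also have "\<dots> = (\<integral>\<^sup>+t. (\<integral>\<^sup>+x. ennreal (y / ((x - t)\<^sup>2 + y\<^sup>2)) * indicator {a..b} t \<partial>L) \<partial>lborel)"
      by (rule Fubini') measurable
    also have "\<dots> = (\<integral>\<^sup>+t. ennreal (- Im (cauchy_transform L (Complex t (- y)))) * indicator {a..b} t \<partial>lborel)"
      by (subst nn_integral_multc) (auto simp: poisson_integral_eq_cauchy_transform[OF L sets y])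
    finally show ?thesis .
  qed
  have "cauchy_transform M (Complex t (- y)) = cauchy_transform N (Complex t (- y))" for t
    using y by (intro eq) simp
  then show ?thesis
    unfolding *[OF M] *[OF N] by simp
qed

text \<open>As the height tends to 0, the arctangent differences approach pi times the indicator of
  an interval. Dominated convergence with bound pi then recovers the masses of all open right rays,
  and these determine a finite measure.\<close>

lemma cauchy_transform_inject:
  assumes M: "finite_measure M" "sets M = sets borel" and N: "finite_measure N" "sets N = sets borel"
    and eq: "\<And>z. Im z < 0 \<Longrightarrow> cauchy_transform M z = cauchy_transform N z"
  shows "M = N"
proof (rule measure_eqI_lessThan)
  fix a :: real
  \<comment> \<open>The left end point approaches a from the right at rate 1 / (n + 1), while the
    height 1 / (n + 1)^2 vanishes faster. Hence the limit at x = a is 0 and an atom at a is not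
    counted with weight one half.\<close>
  define u where "u n x = ennreal (arctan ((a + real (Suc n) - x) / (1 / real (Suc n) ^ 2))
      - arctan ((a + 1 / real (Suc n) - x) / (1 / real (Suc n) ^ 2)))" for n x
  have lim: "(\<lambda>n. u n x) \<longlonglongrightarrow> ennreal pi * indicator {a<..} x" for x
  proof -
    define c where "c = a - x"
    have "(\<lambda>n. arctan ((c + real (Suc n)) / (1 / real (Suc n) ^ 2))
      - arctan ((c + 1 / real (Suc n)) / (1 / real (Suc n) ^ 2))) \<longlonglongrightarrow> (if c < 0 then pi else 0)"
    proof -
      consider "c < 0" | "c = 0" | "c > 0" by linarith
      then show ?thesis
      proof cases
        case 1
        then show ?thesis by simp real_asymp
      next
        case 2
        then show ?thesis by simp real_asymp
      next
        case 3
        then show ?thesis by simp real_asymp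
      qed
    qed
    then have "(\<lambda>n. u n x) \<longlonglongrightarrow> ennreal (if c < 0 then pi else 0)"
      unfolding u_def c_def by (intro tendsto_ennrealI) (simp add: algebra_simps)
    moreover have "ennreal (if c < 0 then pi else 0) = ennreal pi * indicator {a<..} x"
      by (simp add: c_def indicator_def)
    ultimately show ?thesis by simp
  qed
  have bound: "u n x \<le> ennreal pi" for n x
    unfolding u_def
    using arctan_bounded[of "(a + real (Suc n) - x) / (1 / real (Suc n) ^ 2)"]
      arctan_bounded[of "(a + 1 / real (Suc n) - x) / (1 / real (Suc n) ^ 2)"]
    by (intro ennreal_leI) linarith
  have conv: "(\<lambda>n. \<integral>\<^sup>+x. u n x \<partial>L) \<longlonglongrightarrow> ennreal pi * emeasure L {a<..}"
    if L: "finite_measure L" and sets [measurable_cong]: "sets L = sets borel" for L :: "real measure"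
  proof -
    interpret L: finite_measure L by fact
    have "(\<lambda>n. \<integral>\<^sup>+x. u n x \<partial>L) \<longlonglongrightarrow> (\<integral>\<^sup>+x. ennreal pi * indicator {a<..} x \<partial>L)"
    proof (rule nn_integral_dominated_convergence[where w = "\<lambda>_. ennreal pi"])
      show "(\<integral>\<^sup>+x. ennreal pi \<partial>L) < \<infinity>"
        using L.emeasure_finite[of "space L", unfolded infinity_ennreal_def less_top]
        by (simp add: ennreal_mult_less_top)
    qed (use lim bound in \<open>auto simp: u_def\<close>)
    then show ?thesis
      by (simp add: nn_integral_cmult_indicator sets)
  qed
  have "(\<integral>\<^sup>+x. u n x \<partial>M) = (\<integral>\<^sup>+x. u n x \<partial>N)" for n
    unfolding u_def
    by (rule cauchy_transform_eq_imp_arctan_integral_eq[OF M N eq]) (auto simp: field_simps)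
  then have "ennreal pi * emeasure M {a<..} = ennreal pi * emeasure N {a<..}"
    using conv[OF M] conv[OF N] LIMSEQ_unique by simp
  then show "emeasure M {a<..} = emeasure N {a<..}"
    by (simp add: ennreal_mult_cancel_left)
  show "emeasure M {a<..} < \<infinity>"
    using finite_measure.emeasure_finite[OF M(1)] by (simp add: less_top)
qed (use M N in auto)

text \<open>If the difference vanished on the whole vertical ray below x, the identity theorem would
  annihilate it on the lower half-plane, against injectivity. A nonzero value there lets the
  multiplier w(z - 2is) be divided out at the real point x.\<close>

lemma cauchy_transform_diff_nonzero_below:
  assumes MN: "same_moments M N" "M \<noteq> N"
  shows "\<exists>s>0. cauchy_transform M (of_real x - 2 * of_real s * \<i>) \<noteq> cauchy_transform N (of_real x - 2 * of_real s * \<i>)"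
proof (rule ccontr)
  assume contra: "\<not> ?thesis"
  have M: "finite_measure M" "sets M = sets borel" and N: "finite_measure N" "sets N = sets borel"
    using MN by (auto simp: same_moments_def has_all_moments_finite has_all_moments_sets)
  define w where "w z = cauchy_transform M z - cauchy_transform N z" for z
  have "M = N"
  proof (rule cauchy_transform_inject[OF M N])
    fix z assume z: "Im z < 0"
    define U where "U = {complex_of_real x - 2 * of_real s * \<i> | s. s > 0}"
    have "w z = 0"
    proof (rule analytic_continuation[of w "{z. Im z < 0}" U "of_real x - \<i>"])
      show "w holomorphic_on {z. Im z < 0}"
        unfolding w_def using M N by (intro holomorphic_intros cauchy_transform_holomorphic_on) auto
      \<comment> \<open>The point x - i belongs to s = 1/2; the parameter 1/2 + e/4 gives a
        neighbour at distance e/2.\<close>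
      show "(of_real x - \<i>) islimpt U"
        unfolding islimpt_approachable
      proof (intro allI impI)
        fix e :: real assume e: "e > 0"
        show "\<exists>x'\<in>U. x' \<noteq> of_real x - \<i> \<and> dist x' (of_real x - \<i>) < e"
        proof (intro bexI conjI)
          have d: "of_real x - 2 * of_real (1/2 + e/4) * \<i> - (of_real x - \<i>) = - of_real (e/2) * \<i>"
            by (simp add: complex_eq_iff)
          show "of_real x - 2 * of_real (1/2 + e/4) * \<i> \<in> U"
            unfolding U_def using e by (intro CollectI exI[of _ "1/2 + e/4"]) auto
          show "dist (of_real x - 2 * of_real (1/2 + e/4) * \<i>) (of_real x - \<i>) < e"
            unfolding dist_norm d using e by (simp add: norm_mult)
          show "of_real x - 2 * of_real (1/2 + e/4) * \<i> \<noteq> of_real x - \<i>"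
            using d e by auto
        qed
      qed
      show "w y = 0" if "y \<in> U" for y
        using that contra by (auto simp: U_def w_def)
    qed (use z in \<open>auto simp: U_def open_halfspace_Im_lt convex_halfspace_Im_lt intro: convex_connected\<close>)
    then show "cauchy_transform M z = cauchy_transform N z" by (simp add: w_def)
  qed
  with MN show False by simp
qed

section \<open>Closability in terms of coefficients\<close>

definition coeff_closable :: "real measure \<Rightarrow> bool" where
  "coeff_closable M \<longleftrightarrow>
     (\<forall>Q e h. (\<forall>n k. cmod (coeff (Q n) k) \<le> e n) \<and> e \<longlonglongrightarrow> 0 \<and> h \<in> L2 M \<and>
        (\<lambda>n. L2_norm M (\<lambda>x. rpoly (Q n) x - h x)) \<longlonglongrightarrow> 0 \<longrightarrow> (AE x in M. h x = 0))"

lemma norm_le_ell2_norm: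
  assumes "g \<in> finite_seqs"
  shows "cmod (g k) \<le> ell2_norm g"
proof -
  have fin: "finite {n. g n \<noteq> 0}" using assms by (simp add: finite_seqs_def)
  have "summable (\<lambda>n. (cmod (g n))\<^sup>2)"
    by (rule summable_finite[OF fin]) auto
  then have "(\<Sum>n\<in>{k}. (cmod (g n))\<^sup>2) \<le> (\<Sum>n. (cmod (g n))\<^sup>2)"
    by (intro sum_le_suminf) auto
  then show ?thesis
    unfolding ell2_norm_def by (intro real_le_rsqrt) simp
qed

lemma coeff_closable_imp_closable:
  assumes "coeff_closable M"
  shows "closable M moment_op"
  unfolding closable_def
proof (intro allI impI, elim conjE)
  fix g :: "nat \<Rightarrow> nat \<Rightarrow> complex" and f :: "real \<Rightarrow> complex"
  assume g: "\<forall>n. g n \<in> finite_seqs" and f: "f \<in> L2 M" and lim0: "(\<lambda>n. ell2_norm (g n)) \<longlonglongrightarrow> 0"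
    and lim: "(\<lambda>n. L2_norm M (\<lambda>x. moment_op (g n) x - f x)) \<longlonglongrightarrow> 0"
  define Q where "Q n = (\<Sum>k | g n k \<noteq> 0. monom (g n k) k)" for n
  have fin: "finite {k. g n k \<noteq> 0}" for n
    using g by (simp add: finite_seqs_def)
  have "coeff (Q n) k = g n k" for n k
    using fin[of n] by (auto simp: Q_def coeff_sum coeff_monom if_distrib sum.delta cong: if_cong)
  then have "cmod (coeff (Q n) k) \<le> ell2_norm (g n)" for n k
    using g norm_le_ell2_norm by simp
  moreover have "rpoly (Q n) x = moment_op (g n) x" for n x
    by (simp add: Q_def moment_op_def poly_sum poly_monom)
  ultimately show "AE x in M. f x = 0"
    using assms lim0 f lim unfolding coeff_closable_def
    by (elim allE[of _ Q] allE[of _ "\<lambda>n. ell2_norm (g n)"] allE[of _ f]) simp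
qed

text \<open>Comparison with a geometric series. It makes polynomials with uniformly vanishing
  coefficients tend to zero at each point of the open unit disc.\<close>

lemma norm_poly_le_of_coeff_le:
  assumes "\<And>k. cmod (coeff p k) \<le> e" "cmod z < 1"
  shows "cmod (poly p z) \<le> e / (1 - cmod z)"
proof -
  have e: "e \<ge> 0" using order_trans[OF norm_ge_zero assms(1)] .
  have "cmod (poly p z) \<le> (\<Sum>k\<le>degree p. cmod (coeff p k * z ^ k))"
    unfolding poly_altdef by (rule norm_sum)
  also have "\<dots> \<le> (\<Sum>k\<le>degree p. e * cmod z ^ k)"
    unfolding norm_mult norm_power by (intro sum_mono mult_right_mono assms) auto
  also have "\<dots> \<le> (\<Sum>k. e * cmod z ^ k)"
    using assms(2) e by (intro sum_le_suminf summable_mult summable_geometric) auto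
  also have "\<dots> = e / (1 - cmod z)"
    using assms(2) by (simp add: suminf_mult summable_geometric suminf_geometric)
  finally show ?thesis .
qed

text \<open>By Horner's scheme the coefficients of the quotient are the values at z of the tails of
  p, and a geometric series of ratio at most 1/2 bounds each of them.\<close>

lemma norm_coeff_synthetic_div_le:
  assumes "\<And>k. cmod (coeff p k) \<le> e" "cmod z \<le> 1 / 2"
  shows "cmod (coeff (synthetic_div p z) k) \<le> 2 * e"
  using assms(1)
proof (induction p arbitrary: k)
  case 0
  have "0 \<le> e" using 0[of 0] by simp
  then show ?case by simp
next
  case (pCons a p)
  have p: "cmod (coeff p k) \<le> e" for k
    using pCons.prems[of "Suc k"] by simp
  have e: "e \<ge> 0" using order_trans[OF norm_ge_zero p] .
  have "cmod (poly p z) \<le> e / (1 - cmod z)"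
    using p assms(2) by (intro norm_poly_le_of_coeff_le) auto
  also have "\<dots> \<le> e / (1 / 2)"
    using assms(2) e by (intro divide_left_mono) auto
  finally show ?case
    using pCons.IH[OF p] by (cases k) auto
qed

section \<open>Descent of closability from |x - z|^(2k) M to M\<close>

definition power_density :: "complex \<Rightarrow> nat \<Rightarrow> real measure \<Rightarrow> real measure" where
  "power_density z k M = density M (\<lambda>x. ennreal (cmod (complex_of_real x - z) ^ (2 * k)))"

lemma sets_power_density [simp]: "sets (power_density z k M) = sets M"
  by (simp add: power_density_def)

text \<open>Since |x - z|^(2k) |f|^2 = |f (x - z)^k|^2, multiplication by (x - z)^k is an isometry
  from the square-integrable functions of the new measure into those of M.\<close>

lemma
  assumes sets [measurable_cong]: "sets M = sets borel" and [measurable]: "f \<in> borel_measurable M"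
  shows L2_power_density_iff: "f \<in> L2 (power_density z k M) \<longleftrightarrow> (\<lambda>x. f x * (complex_of_real x - z) ^ k) \<in> L2 M"
    and L2_norm_power_density: "L2_norm (power_density z k M) f = L2_norm M (\<lambda>x. f x * (complex_of_real x - z) ^ k)"
proof -
  have eq: "cmod (complex_of_real x - z) ^ (2 * k) * (cmod (f x))\<^sup>2 = (cmod (f x * (complex_of_real x - z) ^ k))\<^sup>2" for x
    by (simp add: norm_mult norm_power power_mult power_mult_distrib mult.commute flip: power_mult)
  have m: "(\<lambda>x. cmod (complex_of_real x - z) ^ (2 * k)) \<in> borel_measurable M" by measurable
  have "integrable (power_density z k M) (\<lambda>x. (cmod (f x))\<^sup>2) \<longleftrightarrow> integrable M (\<lambda>x. (cmod (f x * (complex_of_real x - z) ^ k))\<^sup>2)"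
    unfolding power_density_def using m by (subst integrable_density) (auto simp: eq)
  then show "f \<in> L2 (power_density z k M) \<longleftrightarrow> (\<lambda>x. f x * (complex_of_real x - z) ^ k) \<in> L2 M"
    by (auto simp: L2_def power_density_def)
  have "(\<integral>x. (cmod (f x))\<^sup>2 \<partial>power_density z k M) = (\<integral>x. (cmod (f x * (complex_of_real x - z) ^ k))\<^sup>2 \<partial>M)"
    unfolding power_density_def using m by (subst integral_density) (auto simp: eq)
  then show "L2_norm (power_density z k M) f = L2_norm M (\<lambda>x. f x * (complex_of_real x - z) ^ k)"
    by (simp add: L2_norm_def)
qed

lemma has_all_moments_power_density:
  assumes M: "has_all_moments M"
  shows "has_all_moments (power_density z k M)"
proof -
  note sets = has_all_moments_sets[OF M]
  have "rpoly p \<in> L2 (power_density z k M)" for p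
  proof -
    have "(\<lambda>x. rpoly p x * (complex_of_real x - z) ^ k) = rpoly (p * [:-z, 1:] ^ k)"
      by (auto simp: poly_power)
    then show ?thesis
      using has_all_moments_L2[OF M] L2_power_density_iff[OF sets L2_measurable[OF has_all_moments_L2[OF M]]]
      by metis
  qed
  then show ?thesis by (simp add: has_all_moments_def sets)
qed

lemma power_density_Suc:
  assumes [measurable_cong]: "sets M = sets borel"
  shows "power_density z (Suc k) M = power_density z 1 (power_density z k M)"
proof -
  have "power_density z 1 (power_density z k M)
    = density M (\<lambda>x. ennreal (cmod (complex_of_real x - z) ^ (2 * k)) * ennreal (cmod (complex_of_real x - z) ^ (2 * 1)))"
    unfolding power_density_def by (subst density_density_eq) auto
  also have "\<dots> = power_density z (Suc k) M"
    unfolding power_density_def by (simp flip: ennreal_mult power_add)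
  finally show ?thesis ..
qed

lemma AE_power_density_iff:
  assumes [measurable_cong]: "sets M = sets borel" and z: "Im z \<noteq> 0"
  shows "(AE x in power_density z k M. P x) \<longleftrightarrow> (AE x in M. P x)"
proof -
  have "0 < cmod (complex_of_real x - z) ^ (2 * k)" for x
    using z by (intro zero_less_power) auto
  then show ?thesis
    unfolding power_density_def by (subst AE_density) auto
qed

text \<open>Dividing \<open>Q - Q(z)\<close> by \<open>x - z\<close> turns a null sequence of coefficients into another one,
  because \<open>z\<close> lies inside the unit disc.\<close>

lemma coeff_closable_power_density_1:
  assumes M: "has_all_moments M" and z: "Im z \<noteq> 0" "cmod z \<le> 1 / 2"
    and closable: "coeff_closable (power_density z 1 M)"
  shows "coeff_closable M"
  unfolding coeff_closable_def
proof (intro allI impI, elim conjE)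
  fix Q :: "nat \<Rightarrow> complex poly" and e :: "nat \<Rightarrow> real" and h :: "real \<Rightarrow> complex"
  assume Q: "\<forall>n k. cmod (coeff (Q n) k) \<le> e n" and e: "e \<longlonglongrightarrow> 0" and h: "h \<in> L2 M"
    and lim: "(\<lambda>n. L2_norm M (\<lambda>x. rpoly (Q n) x - h x)) \<longlonglongrightarrow> 0"
  let ?N = "power_density z 1 M"
  note sets [measurable_cong] = has_all_moments_sets[OF M]
  have nz: "complex_of_real x - z \<noteq> 0" for x using z by auto
  have [measurable]: "rpoly p \<in> borel_measurable M" for p
    by (rule L2_measurable[OF has_all_moments_L2[OF M]])
  have [measurable]: "h \<in> borel_measurable M" using h by (simp add: L2_def)
  define h' where "h' x = h x / (complex_of_real x - z)" for x
  have [measurable]: "h' \<in> borel_measurable M" unfolding h'_def by measurable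
  define Q' where "Q' n = synthetic_div (Q n) z" for n
  have Q': "cmod (coeff (Q' n) k) \<le> 2 * e n" for n k
    unfolding Q'_def using Q z by (intro norm_coeff_synthetic_div_le) auto
  have "(\<lambda>x. h' x * (complex_of_real x - z) ^ 1) = h"
    using nz by (auto simp: h'_def)
  then have h': "h' \<in> L2 ?N"
    using h by (subst L2_power_density_iff[OF sets]) auto
  have Qn: "rpoly (Q' n) x * (complex_of_real x - z) = rpoly (Q n) x - poly (Q n) z" for n x
    unfolding Q'_def by (subst (2) synthetic_div_correct'[of z "Q n", symmetric]) (simp add: algebra_simps)
  \<comment> \<open>The isometry turns Q' - h' into Q - h - Q(z). The constant Q(z) is at most 2 e n
    in modulus because |z| <= 1/2, so the quotients converge to h / (x - z) in the new
    space.\<close>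
  have norm: "L2_norm ?N (\<lambda>x. rpoly (Q' n) x - h' x) = L2_norm M (\<lambda>x. (rpoly (Q n) x - h x) + rpoly [:- poly (Q n) z:] x)" for n
  proof -
    have "(\<lambda>x. (rpoly (Q' n) x - h' x) * (complex_of_real x - z) ^ 1) = (\<lambda>x. (rpoly (Q n) x - h x) + rpoly [:- poly (Q n) z:] x)"
    proof
      fix x
      have "h' x * (complex_of_real x - z) = h x" using nz by (simp add: h'_def)
      then show "(rpoly (Q' n) x - h' x) * (complex_of_real x - z) ^ 1 = (rpoly (Q n) x - h x) + rpoly [:- poly (Q n) z:] x"
        using Qn[of n x] by (simp add: algebra_simps)
    qed
    then show ?thesis
      by (subst L2_norm_power_density[OF sets]) auto
  qed
  define m where "m = measure M (space M)"
  have bound: "(L2_norm ?N (\<lambda>x. rpoly (Q' n) x - h' x))\<^sup>2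
      \<le> 2 * (L2_norm M (\<lambda>x. rpoly (Q n) x - h x))\<^sup>2 + 2 * ((2 * e n)\<^sup>2 * m)" for n
  proof -
    have "cmod (poly (Q n) z) \<le> e n / (1 - cmod z)"
      using Q z by (intro norm_poly_le_of_coeff_le) auto
    also have "e n \<ge> 0" using Q norm_ge_zero order_trans by blast
    then have "e n / (1 - cmod z) \<le> e n / (1 / 2)"
      using z by (intro divide_left_mono) auto
    finally have "(cmod (poly (Q n) z))\<^sup>2 * m \<le> (2 * e n)\<^sup>2 * m"
      by (intro mult_right_mono power_mono) (auto simp: m_def)
    moreover have "(L2_norm M (rpoly [:- poly (Q n) z:]))\<^sup>2 = (cmod (poly (Q n) z))\<^sup>2 * m"
      by (simp add: L2_norm_sq m_def)
    ultimately show ?thesis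
      unfolding norm
      using L2_norm_add_sq_le[OF L2_diff[OF has_all_moments_L2[OF M] h] has_all_moments_L2[OF M], of "Q n" "[:- poly (Q n) z:]"]
      by linarith
  qed
  have "(\<lambda>n. 2 * (L2_norm M (\<lambda>x. rpoly (Q n) x - h x))\<^sup>2 + 2 * ((2 * e n)\<^sup>2 * m)) \<longlonglongrightarrow> 2 * 0\<^sup>2 + 2 * ((2 * 0)\<^sup>2 * m)"
    by (intro tendsto_intros lim e)
  then have ub: "(\<lambda>n. 2 * (L2_norm M (\<lambda>x. rpoly (Q n) x - h x))\<^sup>2 + 2 * ((2 * e n)\<^sup>2 * m)) \<longlonglongrightarrow> 0"
    by simp
  have "(\<lambda>n. (L2_norm ?N (\<lambda>x. rpoly (Q' n) x - h' x))\<^sup>2) \<longlonglongrightarrow> 0"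
    by (rule Lim_null_comparison[OF _ ub], rule always_eventually) (use bound in simp)
  then have "(\<lambda>n. sqrt ((L2_norm ?N (\<lambda>x. rpoly (Q' n) x - h' x))\<^sup>2)) \<longlonglongrightarrow> sqrt 0"
    by (rule tendsto_real_sqrt)
  then have lim': "(\<lambda>n. L2_norm ?N (\<lambda>x. rpoly (Q' n) x - h' x)) \<longlonglongrightarrow> 0"
    by simp
  have "(\<lambda>n. 2 * e n) \<longlonglongrightarrow> 0"
    using tendsto_mult_left[OF e, of 2] by simp
  then have "AE x in ?N. h' x = 0"
    using closable Q' h' lim' unfolding coeff_closable_def
    by (elim allE[of _ Q'] allE[of _ "\<lambda>n. 2 * e n"] allE[of _ h']) simp
  then show "AE x in M. h x = 0"
    unfolding AE_power_density_iff[OF sets z(1)] using nz by (simp add: h'_def)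
qed

lemma coeff_closable_power_density:
  assumes "has_all_moments M" "Im z \<noteq> 0" "cmod z \<le> 1 / 2" "coeff_closable (power_density z k M)"
  shows "coeff_closable M"
  using assms(4)
proof (induction k)
  case 0
  then show ?case by (simp add: power_density_def density_1)
next
  case (Suc k)
  then have "coeff_closable (power_density z 1 (power_density z k M))"
    by (simp only: power_density_Suc[OF has_all_moments_sets[OF assms(1)]])
  with Suc.IH show ?case
    using coeff_closable_power_density_1[OF has_all_moments_power_density[OF assms(1)] assms(2,3)] by blast
qed

section \<open>From boundedness of evaluations to closability of indeterminate measures\<close>

lemma poly_sequence_null:
  assumes M: "has_all_moments M" and S: "open S" "connected S" "S \<inter> ball 0 1 \<noteq> {}"
    and g: "g holomorphic_on S"
    and bound: "\<And>p z. z \<in> S \<Longrightarrow> cmod (poly p z * g z) \<le> C * L2_norm M (rpoly p)"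
    and Q: "\<And>n k. cmod (coeff (Q n) k) \<le> e n" and e: "e \<longlonglongrightarrow> 0" and h: "h \<in> L2 M"
    and lim: "(\<lambda>n. L2_norm M (\<lambda>x. rpoly (Q n) x - h x)) \<longlonglongrightarrow> 0"
    and z: "z \<in> S"
  shows "(\<lambda>n. poly (Q n) z * g z) \<longlonglongrightarrow> 0"
proof -
  define F where "F n z = poly (Q n) z * g z" for n z
  \<comment> \<open>The bound on evaluations makes an \<open>L2\<close> Cauchy sequence uniformly
    Cauchy on S after multiplication by g. The holomorphic limit vanishes on the part of S in the
    unit disc, where small coefficients give small values, and hence on all of the connected set
    S.\<close>
  have "uniformly_Cauchy_on S F"
  proof (rule uniformly_Cauchy_onI)
    fix d :: real assume d: "d > 0"
    then have "d / (\<bar>C\<bar> + 1) > 0" by (simp add: add_nonneg_pos)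
    from L2_norm_diff_limit_imp_small[OF has_all_moments_L2[OF M] h lim this]
    obtain K where K: "\<And>m n. m \<ge> K \<Longrightarrow> n \<ge> K \<Longrightarrow> L2_norm M (\<lambda>x. rpoly (Q m) x - rpoly (Q n) x) < d / (\<bar>C\<bar> + 1)"
      by blast
    have "dist (F m y) (F n y) < d" if "y \<in> S" "m \<ge> K" "n \<ge> K" for y m n
    proof -
      have "dist (F m y) (F n y) = cmod (poly (Q m - Q n) y * g y)"
        by (simp add: F_def dist_norm algebra_simps)
      also have "\<dots> \<le> C * L2_norm M (rpoly (Q m - Q n))"
        by (rule bound[OF that(1)])
      also have "\<dots> \<le> (\<bar>C\<bar> + 1) * L2_norm M (rpoly (Q m - Q n))"
        by (intro mult_right_mono) auto
      also have "\<dots> < d"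
        using K[OF that(2,3)] by (simp add: field_simps add_nonneg_pos)
      finally show ?thesis .
    qed
    then show "\<exists>K. \<forall>x\<in>S. \<forall>m\<ge>K. \<forall>n\<ge>K. dist (F m x) (F n x) < d" by blast
  qed
  then obtain \<Phi> where \<Phi>: "uniform_limit S F \<Phi> sequentially"
    using Cauchy_uniformly_convergent uniformly_convergent_on_def by blast
  have "\<Phi> holomorphic_on S"
  proof (rule holomorphic_uniform_sequence[OF S(1)])
    show "F n holomorphic_on S" for n
      unfolding F_def by (intro holomorphic_on_mult g holomorphic_intros)
    fix x assume "x \<in> S"
    then obtain d where "d > 0" "cball x d \<subseteq> S"
      using S(1) open_contains_cball by blast
    then show "\<exists>d>0. cball x d \<subseteq> S \<and> uniform_limit (cball x d) F \<Phi> sequentially"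
      using uniform_limit_on_subset[OF \<Phi>] by blast
  qed
  moreover have "\<Phi> y = 0" if y: "y \<in> S \<inter> ball 0 1" for y
  proof -
    have "(\<lambda>n. poly (Q n) y) \<longlonglongrightarrow> 0"
    proof (rule Lim_null_comparison)
      show "\<forall>\<^sub>F n in sequentially. norm (poly (Q n) y) \<le> e n / (1 - cmod y)"
        using norm_poly_le_of_coeff_le[OF Q] y by (intro always_eventually allI) auto
      show "(\<lambda>n. e n / (1 - cmod y)) \<longlonglongrightarrow> 0"
        using y by (auto intro!: tendsto_eq_intros e)
    qed
    then have "(\<lambda>n. F n y) \<longlonglongrightarrow> 0"
      unfolding F_def by (rule tendsto_mult_left_zero)
    moreover have "(\<lambda>n. F n y) \<longlonglongrightarrow> \<Phi> y"
      using tendsto_uniform_limitI[OF \<Phi>] y by blast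
    ultimately show ?thesis by (metis LIMSEQ_unique)
  qed
  ultimately have "\<Phi> z = 0"
    using analytic_continuation_open[of "S \<inter> ball 0 1" S \<Phi> "\<lambda>_. 0" z] S z
    by (simp add: open_Int)
  then show ?thesis
    using tendsto_uniform_limitI[OF \<Phi> z] by (simp add: F_def)
qed

text \<open>The half-plane Im z < s contains both the origin and the real point x, so
  \<open>poly_sequence_null\<close> applies to the multiplier w(z - 2is). Choosing s with nonzero
  multiplier at x gives pointwise convergence to 0, and Fatou's lemma concludes.\<close>

lemma indeterminate_imp_coeff_closable:
  assumes MN: "same_moments M N" "M \<noteq> N"
  shows "coeff_closable M"
  unfolding coeff_closable_def
proof (intro allI impI, elim conjE)
  fix Q :: "nat \<Rightarrow> complex poly" and e :: "nat \<Rightarrow> real" and h :: "real \<Rightarrow> complex"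
  assume Q: "\<forall>n k. cmod (coeff (Q n) k) \<le> e n" and e: "e \<longlonglongrightarrow> 0" and h: "h \<in> L2 M"
    and lim: "(\<lambda>n. L2_norm M (\<lambda>x. rpoly (Q n) x - h x)) \<longlonglongrightarrow> 0"
  have M: "has_all_moments M" and N: "has_all_moments N"
    using MN by (auto simp: same_moments_def)
  have fin: "finite_measure M" "sets M = sets borel" "finite_measure N" "sets N = sets borel"
    using M N by (auto simp: has_all_moments_finite has_all_moments_sets)
  define w where "w z = cauchy_transform M z - cauchy_transform N z" for z
  have "(\<lambda>n. rpoly (Q n) x) \<longlonglongrightarrow> 0" for x
  proof -
    obtain s where s: "s > 0" "w (of_real x - 2 * of_real s * \<i>) \<noteq> 0"
      using cauchy_transform_diff_nonzero_below[OF MN, of x] by (auto simp: w_def)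
    have "w holomorphic_on (\<lambda>z. z - 2 * of_real s * \<i>) ` {z. Im z < s}"
      unfolding w_def using fin s by (intro holomorphic_intros cauchy_transform_holomorphic_on) auto
    moreover have "(\<lambda>z. z - 2 * of_real s * \<i>) holomorphic_on {z. Im z < s}"
      by (intro holomorphic_intros)
    ultimately have hol: "(\<lambda>z. w (z - 2 * of_real s * \<i>)) holomorphic_on {z. Im z < s}"
      using holomorphic_on_compose[of "\<lambda>z. z - 2 * of_real s * \<i>" "{z. Im z < s}" w]
      by (simp add: o_def)
    have "(\<lambda>n. rpoly (Q n) x * w (of_real x - 2 * of_real s * \<i>)) \<longlonglongrightarrow> 0"
    proof (rule poly_sequence_null[OF M _ _ _ hol _ _ e h lim])
      have "0 \<in> {z. Im z < s} \<inter> ball 0 1" using s by simp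
      then show "{z. Im z < s} \<inter> ball 0 1 \<noteq> {}" by blast
      show "cmod (poly p z * w (z - 2 * of_real s * \<i>)) \<le> 2 * sqrt (measure M (space M)) / s * L2_norm M (rpoly p)"
        if "z \<in> {z. Im z < s}" for p z
        using poly_mult_shifted_cauchy_transform_le[OF MN(1) s(1), of z p] that by (simp add: w_def)
    qed (use Q s in \<open>auto simp: open_halfspace_Im_lt convex_halfspace_Im_lt intro: convex_connected\<close>)
    then show ?thesis
      using s(2) tendsto_mult_right_iff[of "w (of_real x - 2 * of_real s * \<i>)" "\<lambda>n. rpoly (Q n) x" 0] by simp
  qed
  then show "AE x in M. h x = 0"
    by (intro L2_limit_zero_AE[OF has_all_moments_L2[OF M] h lim]) auto
qed

text \<open>Used in contrapositive form as a test for determinacy: a measure with all moments is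
  determinate if evaluation at some real point is discontinuous on polynomials in the
  \<open>L2\<close> norm.\<close>

lemma indeterminate_imp_poly_null:
  assumes MN: "same_moments M N" "M \<noteq> N" and lim: "(\<lambda>n. L2_norm M (rpoly (Q n))) \<longlonglongrightarrow> 0"
  shows "(\<lambda>n. rpoly (Q n) x) \<longlonglongrightarrow> 0"
proof -
  define w where "w z = cauchy_transform M z - cauchy_transform N z" for z
  obtain s where s: "s > 0" "w (of_real x - 2 * of_real s * \<i>) \<noteq> 0"
    using cauchy_transform_diff_nonzero_below[OF MN, of x] by (auto simp: w_def)
  have "(\<lambda>n. rpoly (Q n) x * w (of_real x - 2 * of_real s * \<i>)) \<longlonglongrightarrow> 0"
  proof (rule Lim_null_comparison)
    show "\<forall>\<^sub>F n in sequentially. norm (rpoly (Q n) x * w (of_real x - 2 * of_real s * \<i>))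
        \<le> 2 * sqrt (measure M (space M)) * L2_norm M (rpoly (Q n)) / s"
      using poly_mult_shifted_cauchy_transform_le[OF MN(1) s(1), of "of_real x"] s(1)
      by (intro always_eventually allI) (simp add: w_def)
    show "(\<lambda>n. 2 * sqrt (measure M (space M)) * L2_norm M (rpoly (Q n)) / s) \<longlonglongrightarrow> 0"
      using s(1) by (auto intro!: tendsto_eq_intros lim)
  qed
  then show ?thesis
    using s(2) tendsto_mult_right_iff[of "w (of_real x - 2 * of_real s * \<i>)" "\<lambda>n. rpoly (Q n) x" 0] by simp
qed

section \<open>The index of determinacy\<close>

definition sum_measure :: "real measure \<Rightarrow> real measure \<Rightarrow> real measure" where
  "sum_measure M N = measure_of UNIV (sets borel) (\<lambda>A. emeasure M A + emeasure N A)"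

lemma sets_sum_measure [simp, measurable_cong]: "sets (sum_measure M N) = sets borel"
  using sets.sigma_sets_eq[of "borel :: real measure"] unfolding sum_measure_def by simp

lemma emeasure_sum_measure:
  assumes "sets M = sets borel" "sets N = sets borel" "A \<in> sets borel"
  shows "emeasure (sum_measure M N) A = emeasure M A + emeasure N A"
proof (rule emeasure_measure_of[OF sum_measure_def])
  show "countably_additive (sets (sum_measure M N)) (\<lambda>A. emeasure M A + emeasure N A)"
  proof (rule countably_additiveI)
    fix F :: "nat \<Rightarrow> real set"
    assume F: "range F \<subseteq> sets (sum_measure M N)" "disjoint_family F"
    have "(\<Sum>i. emeasure M (F i) + emeasure N (F i)) = (\<Sum>i. emeasure M (F i)) + (\<Sum>i. emeasure N (F i))"
      by (simp add: suminf_add)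
    then show "(\<Sum>i. emeasure M (F i) + emeasure N (F i)) = emeasure M (\<Union> (range F)) + emeasure N (\<Union> (range F))"
      using F assms by (simp add: suminf_emeasure)
  qed
qed (use assms in \<open>auto simp: positive_def\<close>)

lemma nn_integral_sum_measure:
  assumes [measurable_cong]: "sets M = sets borel" "sets N = sets borel"
    and f: "f \<in> borel_measurable borel"
  shows "(\<integral>\<^sup>+x. f x \<partial>sum_measure M N) = (\<integral>\<^sup>+x. f x \<partial>M) + (\<integral>\<^sup>+x. f x \<partial>N)"
  using f
proof (induction rule: borel_measurable_induct)
  case (cong f g)
  then have "f = g" by auto
  then show ?case using cong by simp
next
  case (set A)
  then show ?case by (simp add: emeasure_sum_measure assms)
next
  case (mult u c)
  then have [measurable]: "u \<in> borel_measurable borel" by simp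
  show ?case using mult by (simp add: nn_integral_cmult distrib_left)
next
  case (add u v)
  then have [measurable]: "u \<in> borel_measurable borel" "v \<in> borel_measurable borel" by simp_all
  show ?case using add by (simp add: nn_integral_add add_ac)
next
  case (seq U)
  then have [measurable]: "\<And>i. U i \<in> borel_measurable borel" by simp
  have inc: "incseq U" by fact
  have inc': "incseq (\<lambda>i. integral\<^sup>N L (U i))" for L
    using inc by (auto simp: incseq_def le_fun_def intro!: nn_integral_mono)
  have *: "integral\<^sup>N L (Sup (range U)) = (SUP i. integral\<^sup>N L (U i))" if [measurable_cong]: "sets L = sets borel" for L
    unfolding SUP_apply[abs_def] by (rule nn_integral_monotone_convergence_SUP[OF inc]) measurable
  show ?case
    using seq.IH unfolding *[OF sets_sum_measure] *[OF assms(1)] *[OF assms(2)]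
    by (simp add: ennreal_SUP_add[OF inc' inc'])
qed

lemma
  fixes f :: "real \<Rightarrow> real"
  assumes sets: "sets M = sets borel" "sets N = sets borel" and f: "integrable M f" "integrable N f"
  shows integrable_sum_measure: "integrable (sum_measure M N) f"
    and integral_sum_measure: "(\<integral>x. f x \<partial>sum_measure M N) = (\<integral>x. f x \<partial>M) + (\<integral>x. f x \<partial>N)"
proof -
  have [measurable]: "f \<in> borel_measurable borel"
    using borel_measurable_integrable[OF f(1)] measurable_cong_sets[OF sets(1) refl] by blast
  note nn = nn_integral_sum_measure[OF sets]
  have fin: "(\<integral>\<^sup>+x. ennreal (f x) \<partial>L) < \<infinity>" "(\<integral>\<^sup>+x. ennreal (- f x) \<partial>L) < \<infinity>"
    if "L = M \<or> L = N" for L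
    using f that by (auto simp: real_integrable_def less_top)
  have fin': "(\<integral>\<^sup>+x. ennreal (f x) \<partial>L) \<noteq> \<infinity>" "(\<integral>\<^sup>+x. ennreal (- f x) \<partial>L) \<noteq> \<infinity>"
    if "L = M \<or> L = N" for L
    using fin[OF that] by auto
  show int: "integrable (sum_measure M N) f"
    using fin' by (simp add: real_integrable_def nn)
  show "(\<integral>x. f x \<partial>sum_measure M N) = (\<integral>x. f x \<partial>M) + (\<integral>x. f x \<partial>N)"
    unfolding real_lebesgue_integral_def[OF int] real_lebesgue_integral_def[OF f(1)] real_lebesgue_integral_def[OF f(2)]
    using fin by (simp add: nn enn2real_plus)
qed

lemma has_all_moments_sum_measure:
  assumes "has_all_moments M" "has_all_moments N"
  shows "has_all_moments (sum_measure M N)"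
proof -
  note sets = has_all_moments_sets[OF assms(1)] has_all_moments_sets[OF assms(2)]
  have "rpoly p \<in> L2 (sum_measure M N)" for p
  proof -
    have "rpoly p \<in> borel_measurable (sum_measure M N)"
      using borel_measurable_rpoly measurable_cong_sets[OF sets_sum_measure refl] by blast
    then show ?thesis
      using integrable_sum_measure[OF sets] assms[THEN has_all_moments_L2, of p]
      by (auto simp: L2_def)
  qed
  then show ?thesis by (simp add: has_all_moments_def)
qed

lemma moment_sum_measure:
  assumes "has_all_moments M" "has_all_moments N"
  shows "moment (sum_measure M N) n = moment M n + moment N n"
  using assms by (simp add: moment_def integral_sum_measure has_all_moments_sets has_all_moments_integrable_power)

section \<open>Determinacy is inherited by bounded densities\<close>

lemma integrable_bounded_mult:
  fixes f g :: "real \<Rightarrow> real"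
  assumes sets: "sets M = sets borel" and f: "integrable M f"
    and g: "g \<in> borel_measurable borel" "\<And>x. 0 \<le> g x" "AE x in M. g x \<le> B"
  shows "integrable M (\<lambda>x. g x * f x)"
proof (rule Bochner_Integration.integrable_bound[OF integrable_mult_right[OF f, of B]])
  have [measurable]: "g \<in> borel_measurable M"
    using g(1) measurable_cong_sets[OF sets refl] by blast
  show "(\<lambda>x. g x * f x) \<in> borel_measurable M"
    using borel_measurable_integrable[OF f] by measurable
  show "AE x in M. norm (g x * f x) \<le> norm (B * f x)"
    using g(3)
  proof eventually_elim
    case (elim x)
    then have "g x * \<bar>f x\<bar> \<le> \<bar>B\<bar> * \<bar>f x\<bar>" by (intro mult_right_mono) auto
    then show ?case using g(2)[of x] by (simp add: abs_mult)
  qed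
qed

lemma
  fixes g :: "real \<Rightarrow> real"
  assumes M: "has_all_moments M" and g: "g \<in> borel_measurable borel" "\<And>x. 0 \<le> g x" "AE x in M. g x \<le> B"
  shows has_all_moments_density_bounded: "has_all_moments (density M g)"
    and moment_density: "moment (density M g) n = (\<integral>x. g x * x ^ n \<partial>M)"
proof -
  note sets = has_all_moments_sets[OF M]
  have gM: "g \<in> borel_measurable M"
    using g(1) measurable_cong_sets[OF sets refl] by blast
  have "rpoly p \<in> L2 (density M g)" for p
  proof -
    have p: "rpoly p \<in> L2 M" by (rule has_all_moments_L2[OF M])
    have "rpoly p \<in> borel_measurable M" by (rule L2_measurable[OF p])
    moreover have "integrable M (\<lambda>x. g x * (cmod (rpoly p x))\<^sup>2)"
      by (rule integrable_bounded_mult[OF sets L2_integrable_sq[OF p] g])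
    ultimately show ?thesis
      using gM g(2) by (auto simp: L2_def integrable_density)
  qed
  then show "has_all_moments (density M g)"
    by (simp add: has_all_moments_def sets)
  have "(\<lambda>x. x ^ n) \<in> borel_measurable M"
    using has_all_moments_integrable_power[OF M] by (rule borel_measurable_integrable)
  then show "moment (density M g) n = (\<integral>x. g x * x ^ n \<partial>M)"
    unfolding moment_def using g(2) gM by (subst integral_density) auto
qed

text \<open>If \<open>M = g N\<close> had a companion \<open>M'\<close> with the same moments, then \<open>M' + (1 - g) N\<close> would be one for \<open>N\<close>.\<close>

lemma determinate_density_le_1:
  fixes g :: "real \<Rightarrow> real"
  assumes N: "determinate N" and g: "g \<in> borel_measurable borel" "\<And>x. 0 \<le> g x" "AE x in N. g x \<le> 1"
  shows "determinate (density N g)"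
proof -
  have hN: "has_all_moments N" using N by (simp add: determinate_def)
  note sets = has_all_moments_sets[OF hN]
  \<comment> \<open>The bound g <= 1 holds almost everywhere only; the maximum keeps the
    complementary density nonnegative everywhere.\<close>
  define k where "k x = max 0 (1 - g x)" for x
  have k: "k \<in> borel_measurable borel" "\<And>x. 0 \<le> k x" "AE x in N. k x \<le> 1"
    using g unfolding k_def by (auto intro!: borel_measurable_max borel_measurable_diff)
  let ?M = "density N g" and ?K = "density N k"
  have hM: "has_all_moments ?M" and hK: "has_all_moments ?K"
    using has_all_moments_density_bounded[OF hN g] has_all_moments_density_bounded[OF hN k] .
  have split: "moment ?M n + moment ?K n = moment N n" for n
  proof -
    have i: "integrable N (\<lambda>x. g x * x ^ n)" "integrable N (\<lambda>x. k x * x ^ n)"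
      using integrable_bounded_mult[OF sets has_all_moments_integrable_power[OF hN]] g k by blast+
    have "moment ?M n + moment ?K n = (\<integral>x. g x * x ^ n + k x * x ^ n \<partial>N)"
      unfolding moment_density[OF hN g] moment_density[OF hN k] using i by simp
    also have "\<dots> = (\<integral>x. x ^ n \<partial>N)"
    proof (rule integral_cong_AE)
      show "AE x in N. g x * x ^ n + k x * x ^ n = x ^ n"
        using g(3) by eventually_elim (simp add: k_def flip: distrib_right)
      show "(\<lambda>x. x ^ n) \<in> borel_measurable N"
        using has_all_moments_integrable_power[OF hN] by (rule borel_measurable_integrable)
      show "(\<lambda>x. g x * x ^ n + k x * x ^ n) \<in> borel_measurable N"
        using i by (intro borel_measurable_integrable Bochner_Integration.integrable_add)
    qed
    finally show ?thesis by (simp add: moment_def)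
  qed
  \<comment> \<open>The measure \<open>?M\<close> is itself such an L. Comparing the two sums and
    cancelling the finite measure \<open>?K\<close> gives L = \<open>?M\<close>.\<close>
  have eqN: "sum_measure L ?K = N" if L: "has_all_moments L" "\<forall>n. moment L n = moment ?M n" for L
    using N has_all_moments_sum_measure[OF L(1) hK] moment_sum_measure[OF L(1) hK] L(2) split
    by (auto simp: determinate_def)
  have "L = ?M" if L: "has_all_moments L" "\<forall>n. moment L n = moment ?M n" for L
  proof (rule measure_eqI)
    show "sets L = sets ?M" using L(1) by (simp add: has_all_moments_sets sets)
    fix A assume "A \<in> sets L"
    then have A: "A \<in> sets borel" using has_all_moments_sets[OF L(1)] by simp
    have "emeasure L A + emeasure ?K A = emeasure ?M A + emeasure ?K A"
      using emeasure_sum_measure[OF has_all_moments_sets[OF L(1)] has_all_moments_sets[OF hK] A]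
        emeasure_sum_measure[OF has_all_moments_sets[OF hM] has_all_moments_sets[OF hK] A]
        eqN[OF L] eqN[OF hM] by simp
    moreover have "emeasure ?K A \<noteq> \<infinity>"
      using finite_measure.emeasure_finite[OF has_all_moments_finite[OF hK]] by simp
    ultimately show "emeasure L A = emeasure ?M A"
      by (metis add.commute ennreal_add_left_cancel infinity_ennreal_def)
  qed
  then show ?thesis using hM by (simp add: determinate_def)
qed

lemma
  fixes c :: real
  assumes M: "has_all_moments M" and c: "c \<ge> 0"
  shows has_all_moments_scale: "has_all_moments (density M (\<lambda>_. c))"
    and moment_scale: "moment (density M (\<lambda>_. c)) n = c * moment M n"
  using has_all_moments_density_bounded[OF M, of "\<lambda>_. c" c] moment_density[OF M, of "\<lambda>_. c" c n] c
  by (auto simp: moment_def)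

lemma determinate_scale:
  fixes c :: real
  assumes M: "determinate M" and c: "c > 0"
  shows "determinate (density M (\<lambda>_. c))"
proof -
  have hM: "has_all_moments M" using M by (simp add: determinate_def)
  have "L = density M (\<lambda>_. c)"
    if L: "has_all_moments L" "\<forall>n. moment L n = moment (density M (\<lambda>_. c)) n" for L
  proof -
    have "has_all_moments (density L (\<lambda>_. ennreal (1 / c)))"
      "\<forall>n. moment (density L (\<lambda>_. ennreal (1 / c))) n = moment M n"
      using L c by (auto simp: has_all_moments_scale moment_scale[OF L(1)] moment_scale[OF hM])
    then have "density L (\<lambda>_. ennreal (1 / c)) = M"
      using M by (simp add: determinate_def)
    then have "density M (\<lambda>_. c) = density (density L (\<lambda>_. ennreal (1 / c))) (\<lambda>_. c)" by simp
    also have "\<dots> = density L (\<lambda>_. ennreal (1 / c) * ennreal c)"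
      by (rule density_density_eq) auto
    also have "\<dots> = L" using c by (simp add: density_1 flip: ennreal_mult)
    finally show ?thesis ..
  qed
  then show ?thesis
    using has_all_moments_scale[OF hM, of c] c by (simp add: determinate_def)
qed

lemma determinate_density_bounded:
  fixes g :: "real \<Rightarrow> real"
  assumes N: "determinate N" and g: "g \<in> borel_measurable borel" "\<And>x. 0 \<le> g x" "AE x in N. g x \<le> B"
    and B: "B > 0"
  shows "determinate (density N g)"
proof -
  have sets: "sets N = sets borel" using N by (simp add: determinate_def has_all_moments_def)
  have gN: "g \<in> borel_measurable N"
    using g(1) measurable_cong_sets[OF sets refl] by blast
  have m: "(\<lambda>x. g x / B) \<in> borel_measurable borel"
    using g(1) by measurable
  have "determinate (density N (\<lambda>x. g x / B))"
    by (rule determinate_density_le_1[OF N m]) (use g B in \<open>auto elim: eventually_mono\<close>)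
  then have "determinate (density (density N (\<lambda>x. g x / B)) (\<lambda>_. B))"
    using B by (rule determinate_scale)
  also have "density (density N (\<lambda>x. g x / B)) (\<lambda>_. B) = density N (\<lambda>x. ennreal (g x / B) * ennreal B)"
    using gN by (intro density_density_eq) auto
  also have "\<dots> = density N g"
    using B g(2) by (simp flip: ennreal_mult)
  finally show ?thesis .
qed

section \<open>Independence of the index from the base point, and measures of finite index\<close>

lemma AE_dist_ge_of_not_in_supp:
  assumes sets: "sets M = sets borel" and z: "z \<notin> complex_of_real ` supp M"
  shows "\<exists>\<epsilon>>0. AE x in M. \<epsilon> \<le> cmod (complex_of_real x - z)"
proof (cases "Im z = 0")
  case False
  then show ?thesis
    using abs_Im_le_cmod_diff[of z] by (intro exI[of _ "\<bar>Im z\<bar>"]) auto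
next
  case True
  define t where "t = Re z"
  have zt: "z = complex_of_real t" using True by (simp add: t_def complex_eq_iff)
  then have "t \<notin> supp M" using z by auto
  then obtain U where U: "open U" "t \<in> U" "emeasure M U = 0"
    by (auto simp: supp_def)
  then obtain \<epsilon> where \<epsilon>: "\<epsilon> > 0" "ball t \<epsilon> \<subseteq> U"
    by (meson openE)
  have "AE x in M. x \<notin> U"
    using U sets by (intro AE_I[of _ _ U]) auto
  then have "AE x in M. \<epsilon> \<le> cmod (complex_of_real x - z)"
  proof eventually_elim
    case (elim x)
    then have "x \<notin> ball t \<epsilon>" using \<epsilon> by blast
    then show ?case
      unfolding zt by (simp add: dist_real_def abs_minus_commute flip: of_real_diff)
  qed
  then show ?thesis using \<epsilon>(1) by blast
qed

text \<open>Almost everywhere |x - z| is bounded away from 0, so the ratio |x - w| / |x - z| is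
  bounded and the measure for w is a bounded density times the measure for z.\<close>

lemma determinate_power_density_cong:
  assumes M: "has_all_moments M"
    and z: "z \<notin> complex_of_real ` supp M"
    and det: "determinate (power_density z k M)"
  shows "determinate (power_density w k M)"
proof -
  note sets [measurable_cong] = has_all_moments_sets[OF M]
  obtain \<epsilon> where \<epsilon>: "\<epsilon> > 0" "AE x in M. \<epsilon> \<le> cmod (complex_of_real x - z)"
    using AE_dist_ge_of_not_in_supp[OF sets z] by blast
  define r where "r x = (cmod (complex_of_real x - w) / cmod (complex_of_real x - z)) ^ (2 * k)" for x
  \<comment> \<open>From |x - w| <= |x - z| + |z - w| and |z - w| <= (|z - w| / \<epsilon>) |x -
    z|.\<close>
  define B where "B = (1 + cmod (z - w) / \<epsilon>) ^ (2 * k)"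
  have r: "r \<in> borel_measurable borel" "\<And>x. 0 \<le> r x" unfolding r_def by auto
  have B: "B > 0" unfolding B_def using \<epsilon>(1) by (intro zero_less_power add_pos_nonneg) auto
  have "AE x in M. r x \<le> B"
    using \<epsilon>(2)
  proof eventually_elim
    case (elim x)
    have "cmod (complex_of_real x - w) \<le> cmod (complex_of_real x - z) + cmod (z - w)"
      using norm_triangle_ineq[of "complex_of_real x - z" "z - w"] by simp
    also have "cmod (z - w) \<le> cmod (z - w) / \<epsilon> * cmod (complex_of_real x - z)"
      using elim \<epsilon>(1) mult_left_mono[OF elim norm_ge_zero[of "z - w"]] by (simp add: field_simps)
    finally have le: "cmod (complex_of_real x - w) \<le> (1 + cmod (z - w) / \<epsilon>) * cmod (complex_of_real x - z)"
      by (simp add: distrib_right)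
    have "cmod (complex_of_real x - z) > 0"
      using elim \<epsilon>(1) by (rule order.strict_trans2[rotated])
    then have "cmod (complex_of_real x - w) / cmod (complex_of_real x - z) \<le> 1 + cmod (z - w) / \<epsilon>"
      using le by (subst pos_divide_le_eq)
    then show ?case
      unfolding r_def B_def by (rule power_mono) simp
  qed
  then have "AE x in power_density z k M. r x \<le> B"
    unfolding power_density_def by (subst AE_density) auto
  then have "determinate (density (power_density z k M) r)"
    by (rule determinate_density_bounded[OF det r _ B])
  also have "density (power_density z k M) r
    = density M (\<lambda>x. ennreal (cmod (complex_of_real x - z) ^ (2 * k)) * ennreal (r x))"
    unfolding power_density_def using r(1) by (intro density_density_eq) auto
  also have "\<dots> = power_density w k M"
    unfolding power_density_def
  proof (rule density_cong)
    show "AE x in M. ennreal (cmod (complex_of_real x - z) ^ (2 * k)) * ennreal (r x) = ennreal (cmod (complex_of_real x - w) ^ (2 * k))"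
      using \<epsilon>(2)
    proof eventually_elim
      case (elim x)
      then have "cmod (complex_of_real x - z) \<noteq> 0" using \<epsilon>(1) by auto
      then show ?case
        unfolding r_def by (simp add: power_divide flip: ennreal_mult)
    qed
  qed (use r(1) in auto)
  finally show ?thesis .
qed

text \<open>Off the support the admissible exponents k form the same set, so a common value exists;
  the given point z makes it unique, which justifies the definite description.\<close>

lemma index_of_determinacy_eq:
  assumes M: "has_all_moments M" and z: "z \<notin> complex_of_real ` supp M"
  shows "index_of_determinacy M = ind_at z M"
  unfolding index_of_determinacy_def
proof (rule the_equality)
  have "{k. determinate (power_density w k M)} = {k. determinate (power_density z k M)}"
    if "w \<in> - complex_of_real ` supp M" for w
    using determinate_power_density_cong[OF M, of z] determinate_power_density_cong[OF M, of w] z that by blast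
  then show "\<forall>w \<in> - complex_of_real ` supp M. ind_at w M = ind_at z M"
    unfolding ind_at_def power_density_def[symmetric] by simp
qed (use z in auto)

text \<open>Were all the measures |x - z|^(2k) M determinate, the supremum defining the index would
  be infinite. So one of them is indeterminate, and its closability descends to M.\<close>

lemma finite_index_of_determinacy_imp_closable:
  assumes M: "determinate M" and ind: "index_of_determinacy M < \<infinity>"
  shows "closable M moment_op"
proof -
  \<comment> \<open>This point is not real, hence off the support, and its modulus is small enough
    for the bound on synthetic division.\<close>
  define z :: complex where "z = \<i> / 2"
  have z: "Im z \<noteq> 0" "cmod z \<le> 1 / 2" "z \<notin> complex_of_real ` supp M"
    by (auto simp: z_def norm_divide complex_eq_iff)
  have hM: "has_all_moments M" using M by (simp add: determinate_def)
  have "\<exists>k. \<not> determinate (power_density z k M)"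
  proof (rule ccontr)
    assume "\<nexists>k. \<not> determinate (power_density z k M)"
    then have "ind_at z M = Sup (range enat)"
      by (simp add: ind_at_def flip: power_density_def)
    moreover have "infinite (range enat)"
      by (simp add: finite_image_iff inj_on_def)
    ultimately have "ind_at z M = \<infinity>" by (auto simp: Sup_enat_def)
    then show False using ind index_of_determinacy_eq[OF hM z(3)] by simp
  qed
  then obtain k where "\<not> determinate (power_density z k M)" by blast
  then obtain N where "same_moments (power_density z k M) N" "power_density z k M \<noteq> N"
    using has_all_moments_power_density[OF hM, of z k]
    unfolding determinate_def same_moments_def by metis
  then have "coeff_closable (power_density z k M)"
    by (rule indeterminate_imp_coeff_closable)
  then show ?thesis
    by (intro coeff_closable_imp_closable coeff_closable_power_density[OF hM z(1,2)])
qed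

section \<open>A determinate measure on a geometric progression\<close>

text \<open>The exponent balances two growth rates. The products of |1 - 4^(n-m)| over m < n have
  squares of at most 4^(n (n + 1)), against which the weight still leaves 4^(-n). Multiplication by
  |x - z|^2 raises the weight at 4^n to about 4^(-n^2), and then squared Lagrange coefficients of
  order 4^(-n (n + 1)) win by 4^(-n).\<close>

definition geo_weight :: "nat \<Rightarrow> real" where
  "geo_weight n = (1 / 4) ^ (n * (n + 2))"

definition geo_measure :: "real measure" where
  "geo_measure = distr (density (count_space UNIV) (\<lambda>n. ennreal (geo_weight n))) borel (\<lambda>n. 4 ^ n)"

lemma geo_weight_pos: "geo_weight n > 0"
  by (simp add: geo_weight_def)

lemma geo_weight_nonneg [simp]: "geo_weight n \<ge> 0"
  by (simp add: geo_weight_def)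

lemma abs_geo_weight [simp]: "\<bar>geo_weight n\<bar> = geo_weight n"
  by (simp add: geo_weight_def)

lemma sets_geo_measure [simp, measurable_cong]: "sets geo_measure = sets borel"
  by (simp add: geo_measure_def)

lemma integrable_geo_measure_iff:
  assumes "f \<in> borel_measurable borel"
  shows "integrable geo_measure f \<longleftrightarrow> summable (\<lambda>n. geo_weight n * \<bar>f (4 ^ n) :: real\<bar>)"
proof -
  have "integrable geo_measure f \<longleftrightarrow> integrable (density (count_space UNIV) (\<lambda>n. ennreal (geo_weight n))) (\<lambda>n. f (4 ^ n))"
    unfolding geo_measure_def using assms by (intro integrable_distr_eq) auto
  also have "\<dots> \<longleftrightarrow> integrable (count_space UNIV) (\<lambda>n. geo_weight n * f (4 ^ n))"
    using geo_weight_pos less_imp_le by (subst integrable_density) auto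
  also have "\<dots> \<longleftrightarrow> summable (\<lambda>n. geo_weight n * \<bar>f (4 ^ n)\<bar>)"
    using geo_weight_pos less_imp_le by (simp add: integrable_count_space_nat_iff abs_mult)
  finally show ?thesis .
qed

lemma integral_geo_measure:
  fixes f :: "real \<Rightarrow> real"
  assumes "f \<in> borel_measurable borel" "integrable geo_measure f"
  shows "(\<integral>x. f x \<partial>geo_measure) = (\<Sum>n. geo_weight n * f (4 ^ n))"
proof -
  have "summable (\<lambda>n. geo_weight n * \<bar>f (4 ^ n)\<bar>)"
    using assms integrable_geo_measure_iff by blast
  then have int: "integrable (count_space UNIV) (\<lambda>n. geo_weight n * f (4 ^ n))"
    using geo_weight_pos less_imp_le by (simp add: integrable_count_space_nat_iff abs_mult)
  have "(\<integral>x. f x \<partial>geo_measure) = (\<integral>n. f (4 ^ n) \<partial>density (count_space UNIV) (\<lambda>n. ennreal (geo_weight n)))"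
    unfolding geo_measure_def using assms(1) by (intro integral_distr) auto
  also have "\<dots> = (\<integral>n. geo_weight n * f (4 ^ n) \<partial>count_space UNIV)"
    using geo_weight_pos less_imp_le by (subst integral_density) auto
  also have "\<dots> = (\<Sum>n. geo_weight n * f (4 ^ n))"
    using int by (rule integral_count_space_nat)
  finally show ?thesis .
qed

lemma norm_poly_le_power:
  assumes "1 \<le> cmod z"
  shows "cmod (poly p z) \<le> (\<Sum>k\<le>degree p. cmod (coeff p k)) * cmod z ^ degree p"
proof -
  have "cmod (poly p z) \<le> (\<Sum>k\<le>degree p. cmod (coeff p k * z ^ k))"
    unfolding poly_altdef by (rule norm_sum)
  also have "\<dots> \<le> (\<Sum>k\<le>degree p. cmod (coeff p k) * cmod z ^ degree p)"
    unfolding norm_mult norm_power using assms by (intro sum_mono mult_left_mono power_increasing) auto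
  finally show ?thesis by (simp add: sum_distrib_right)
qed

lemma borel_measurable_sq_rpoly: "(\<lambda>x. (cmod (rpoly p x))\<^sup>2) \<in> borel_measurable borel"
  by (intro borel_measurable_continuous_onI continuous_intros)

lemma has_all_moments_geo_measure: "has_all_moments geo_measure"
proof -
  have "rpoly p \<in> L2 geo_measure" for p
  proof -
    define C d where "C = (\<Sum>k\<le>degree p. cmod (coeff p k))" and "d = degree p"
    have "summable (\<lambda>n. geo_weight n * \<bar>(cmod (rpoly p (4 ^ n)))\<^sup>2\<bar>)"
    proof (rule summable_comparison_test_ev)
      show "summable (\<lambda>n. C\<^sup>2 * (1 / 4 :: real) ^ n)"
        by (intro summable_mult summable_geometric) auto
      show "\<forall>\<^sub>F n in sequentially. norm (geo_weight n * \<bar>(cmod (rpoly p (4 ^ n)))\<^sup>2\<bar>) \<le> C\<^sup>2 * (1 / 4) ^ n"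
        \<comment> \<open>For n >= 2d the quadratic exponent n (n + 2) is at least n + 2dn, which
          absorbs the growth 4^(2dn) of the squared polynomial and leaves 4^(-n).\<close>
        using eventually_ge_at_top[of "2 * d"]
      proof eventually_elim
        case (elim n)
        have "cmod (rpoly p (4 ^ n)) \<le> C * (4 ^ n) ^ d"
          using norm_poly_le_power[of "complex_of_real (4 ^ n)" p] by (simp add: C_def d_def norm_power)
        then have "(cmod (rpoly p (4 ^ n)))\<^sup>2 \<le> (C * (4 ^ n) ^ d)\<^sup>2"
          by (intro power_mono) auto
        also have "\<dots> = C\<^sup>2 * 4 ^ (2 * d * n)"
          by (simp add: power_mult_distrib mult_ac flip: power_mult)
        finally have "geo_weight n * (cmod (rpoly p (4 ^ n)))\<^sup>2 \<le> (1 / 4) ^ (n * (n + 2)) * (C\<^sup>2 * 4 ^ (2 * d * n))"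
          unfolding geo_weight_def by (intro mult_left_mono) auto
        also have "\<dots> \<le> (1 / 4) ^ (n + 2 * d * n) * (C\<^sup>2 * 4 ^ (2 * d * n))"
        proof (intro mult_right_mono power_decreasing)
          have "2 * d * n \<le> n * n" using elim by (intro mult_right_mono) auto
          then show "n + 2 * d * n \<le> n * (n + 2)" unfolding distrib_left by linarith
        qed auto
        also have "\<dots> = C\<^sup>2 * (1 / 4) ^ n"
          by (simp add: power_add power_one_over)
        finally show ?case
          using geo_weight_pos[of n] by (simp add: abs_mult)
      qed
    qed
    then have "integrable geo_measure (\<lambda>x. (cmod (rpoly p x))\<^sup>2)"
      by (subst integrable_geo_measure_iff[OF borel_measurable_sq_rpoly])
    moreover have "rpoly p \<in> borel_measurable borel"
      by (rule borel_measurable_rpoly)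
    then have "rpoly p \<in> borel_measurable geo_measure"
      using measurable_cong_sets[OF sets_geo_measure refl] by blast
    ultimately show ?thesis by (simp add: L2_def)
  qed
  then show ?thesis by (simp add: has_all_moments_def)
qed

lemma geo_measure_sums_sq:
  "(\<lambda>n. geo_weight n * (cmod (rpoly p (4 ^ n)))\<^sup>2) sums (L2_norm geo_measure (rpoly p))\<^sup>2"
proof -
  have int: "integrable geo_measure (\<lambda>x. (cmod (rpoly p x))\<^sup>2)"
    by (rule L2_integrable_sq[OF has_all_moments_L2[OF has_all_moments_geo_measure]])
  then have "summable (\<lambda>n. geo_weight n * (cmod (rpoly p (4 ^ n)))\<^sup>2)"
    using integrable_geo_measure_iff[OF borel_measurable_sq_rpoly, of p] by simp
  then show ?thesis
    unfolding L2_norm_sq integral_geo_measure[OF borel_measurable_sq_rpoly int]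
    by (rule summable_sums)
qed

lemma unbounded_supp_geo_measure: "\<not> bounded (supp geo_measure)"
proof
  assume "bounded (supp geo_measure)"
  then obtain B where B: "\<And>x. x \<in> supp geo_measure \<Longrightarrow> \<bar>x\<bar> \<le> B"
    unfolding bounded_iff by auto
  have "4 ^ n \<in> supp geo_measure" for n
    unfolding supp_def
  proof (intro CollectI allI impI)
    fix U :: "real set" assume U: "open U \<and> 4 ^ n \<in> U"
    let ?D = "density (count_space UNIV) (\<lambda>n. ennreal (geo_weight n))"
    have "0 < ennreal (geo_weight n)" using geo_weight_pos by simp
    also have "\<dots> = emeasure ?D {n}"
      by (simp add: emeasure_density)
    also have "\<dots> \<le> emeasure ?D ((\<lambda>n. 4 ^ n) -` U \<inter> space ?D)"
      using U by (intro emeasure_mono) auto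
    also have "\<dots> = emeasure geo_measure U"
      unfolding geo_measure_def using U by (subst emeasure_distr) auto
    finally show "0 < emeasure geo_measure U" .
  qed
  then have *: "(4::real) ^ n \<le> B" for n
    using B[of "4 ^ n"] by simp
  obtain n where "B < 4 ^ n" using real_arch_pow[of 4 B] by auto
  with *[of n] show False by simp
qed

section \<open>Determinacy through unbounded evaluation at the origin\<close>

lemma double_sum_diff: "2 * (\<Sum>m<n. n - m) = n * (n + 1 :: nat)"
  by (induction n) (simp_all add: sum.lessThan_Suc_shift del: sum.lessThan_Suc)

text \<open>The polynomials \<open>\<Prod>m<N. (1 - x / 4 ^ m)\<close> tend to zero in the mean but equal 1 at the origin.\<close>

lemma determinate_geo_measure: "determinate geo_measure"
proof (rule ccontr)
  assume "\<not> determinate geo_measure"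
  then obtain M where M: "same_moments geo_measure M" "geo_measure \<noteq> M"
    using has_all_moments_geo_measure unfolding determinate_def same_moments_def by metis
  define Q :: "nat \<Rightarrow> complex poly" where "Q N = (\<Prod>m<N. [:1, - 1 / 4 ^ m:])" for N
  \<comment> \<open>The polynomial vanishes at the nodes with n < N. For n >= N its square is at
    most 4^(n (n + 1)), so 4^(-n) = 2^(-n) 2^(-n) remains: one factor is bounded by 2^(-N), the
    other is summable in n.\<close>
  have term_le: "geo_weight n * (cmod (rpoly (Q N) (4 ^ n)))\<^sup>2 \<le> (1 / 2) ^ N * (1 / 2) ^ n" for n N
  proof (cases "n < N")
    case True
    then have "rpoly (Q N) (4 ^ n) = 0"
      by (auto simp: Q_def poly_prod intro!: bexI[of _ n])
    then show ?thesis by simp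
  next
    case False
    have "cmod (rpoly (Q N) (4 ^ n)) = (\<Prod>m<N. cmod (1 - 4 ^ n / 4 ^ m))"
      by (simp add: Q_def poly_prod flip: prod_norm)
    also have "\<dots> \<le> (\<Prod>m<N. 4 ^ (n - m))"
    proof (intro prod_mono conjI)
      fix m assume "m \<in> {..<N}"
      then have "m \<le> n" using False by simp
      then have "1 - (4::complex) ^ n / 4 ^ m = complex_of_real (1 - 4 ^ (n - m))"
        by (simp add: power_diff)
      then have "cmod (1 - 4 ^ n / 4 ^ m) = \<bar>1 - 4 ^ (n - m)\<bar>"
        by (simp only: norm_of_real)
      then show "cmod (1 - 4 ^ n / 4 ^ m) \<le> 4 ^ (n - m)"
        by simp
    qed auto
    also have "\<dots> = 4 ^ (\<Sum>m<N. n - m)" by (simp add: power_sum)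
    also have "\<dots> \<le> 4 ^ (\<Sum>m<n. n - m)"
      using False by (intro power_increasing sum_mono2) auto
    finally have "(cmod (rpoly (Q N) (4 ^ n)))\<^sup>2 \<le> (4 ^ (\<Sum>m<n. n - m))\<^sup>2"
      by (intro power_mono) auto
    also have "\<dots> = 4 ^ (n * (n + 1))"
      by (simp only: power_mult[symmetric] double_sum_diff[symmetric] mult.commute)
    finally have "geo_weight n * (cmod (rpoly (Q N) (4 ^ n)))\<^sup>2 \<le> geo_weight n * 4 ^ (n * (n + 1))"
      using geo_weight_pos[of n] by (intro mult_left_mono) auto
    also have "\<dots> = (1 / 4) ^ n"
    proof -
      have "n * (n + 2) = n * (n + 1) + n" by (simp add: algebra_simps)
      then show ?thesis unfolding geo_weight_def by (simp only: power_add) (simp add: power_one_over)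
    qed
    also have "(1 / 4 :: real) ^ n = (1 / 2) ^ n * (1 / 2) ^ n"
      by (simp flip: power_mult_distrib)
    also have "\<dots> \<le> (1 / 2) ^ N * (1 / 2) ^ n"
      using False by (intro mult_right_mono power_decreasing) auto
    finally show ?thesis .
  qed
  have "(\<lambda>N. L2_norm geo_measure (rpoly (Q N))) \<longlonglongrightarrow> 0"
  proof (rule Lim_null_comparison)
    have "(L2_norm geo_measure (rpoly (Q N)))\<^sup>2 \<le> (1 / 2) ^ N * 2" for N
    proof (rule sums_le[OF term_le geo_measure_sums_sq])
      show "(\<lambda>n. (1 / 2) ^ N * (1 / 2) ^ n) sums ((1 / 2 :: real) ^ N * 2)"
        using geometric_sums[of "1 / 2 :: real"] by (intro sums_mult) simp
    qed
    then show "\<forall>\<^sub>F N in sequentially. norm (L2_norm geo_measure (rpoly (Q N))) \<le> sqrt ((1 / 2) ^ N * 2)"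
      by (intro always_eventually allI) (simp add: real_le_rsqrt)
    have "(\<lambda>N. sqrt ((1 / 2) ^ N * 2)) \<longlonglongrightarrow> sqrt (0 * 2)"
      by (intro tendsto_intros LIMSEQ_power_zero) auto
    then show "(\<lambda>N. sqrt ((1 / 2) ^ N * 2)) \<longlonglongrightarrow> 0" by simp
  qed
  then have "(\<lambda>N. rpoly (Q N) 0) \<longlonglongrightarrow> 0"
    by (rule indeterminate_imp_poly_null[OF M])
  moreover have "rpoly (Q N) 0 = 1" for N
    by (simp add: Q_def poly_prod)
  ultimately show False by (simp add: LIMSEQ_const_iff)
qed

section \<open>Lagrange interpolation at the nodes 4^n\<close>

lemma lagrange_interpolation:
  fixes p :: "'a :: field poly" and x :: "'i \<Rightarrow> 'a"
  assumes I: "finite I" "inj_on x I" "degree p < card I"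
  shows "poly p y = (\<Sum>n\<in>I. poly p (x n) * (\<Prod>m\<in>I - {n}. (y - x m) / (x n - x m)))"
proof -
  define L where "L n = (\<Prod>m\<in>I - {n}. [:- x m / (x n - x m), 1 / (x n - x m):])" for n
  define q where "q = (\<Sum>n\<in>I. smult (poly p (x n)) (L n))"
  have L: "poly (L n) y = (\<Prod>m\<in>I - {n}. (y - x m) / (x n - x m))" for n y
    by (simp add: L_def poly_prod diff_divide_distrib add.commute)
  have "degree (L n) \<le> card I - 1" if "n \<in> I" for n
  proof -
    have "degree (L n) \<le> (\<Sum>m\<in>I - {n}. degree [:- x m / (x n - x m), 1 / (x n - x m):])"
      unfolding L_def using degree_prod_sum_le[of "I - {n}"] I(1) unfolding o_def by blast
    also have "\<dots> \<le> (\<Sum>m\<in>I - {n}. 1)"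
      by (intro sum_mono) simp
    finally show ?thesis using I that by simp
  qed
  then have "degree q \<le> card I - 1"
    unfolding q_def using I by (intro degree_sum_le order_trans[OF degree_smult_le]) auto
  moreover have "poly q (x k) = poly p (x k)" if k: "k \<in> I" for k
  proof -
    have "poly (L n) (x k) = (if n = k then 1 else 0)" if n: "n \<in> I" for n
    proof (cases "n = k")
      case True
      have "x k - x m \<noteq> 0" if "m \<in> I - {k}" for m
        using I(2) k that by (auto dest: inj_onD)
      then show ?thesis using True by (simp add: L)
    next
      case False
      then show ?thesis using I(1) k unfolding L by (auto intro!: prod_zero bexI[of _ k])
    qed
    then have "poly q (x k) = (\<Sum>n\<in>I. poly p (x n) * (if n = k then 1 else 0))"
      unfolding q_def poly_sum poly_smult by (intro sum.cong) auto
    then show ?thesis using I(1) k by (simp add: if_distrib sum.delta cong: if_cong)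
  qed
  ultimately have "q = p"
    using I by (intro poly_eqI_degree[of "x ` I"]) (auto simp: card_image)
  then have "poly p y = poly q y" by simp
  then show ?thesis by (simp add: q_def poly_sum L)
qed

lemma geometric_sum_quarter_le: "(\<Sum>i<n. (1 / 4 :: real) ^ i) \<le> 4 / 3"
proof -
  have "(\<Sum>i<n. (1 / 4 :: real) ^ i) = 4 / 3 * (1 - (1 / 4) ^ n)"
    by (subst sum_gp_strict) simp
  then show ?thesis by simp
qed

text \<open>The exponent is |n - m| written with truncated subtraction. Each side of n contributes
  at most 1/4 times 4/3, that is 1/3.\<close>

lemma sum_quarter_dist_le: "(\<Sum>m\<in>{..<N} - {n}. (1 / 4 :: real) ^ ((n - m) + (m - n))) \<le> 1"
proof -
  have "(\<Sum>m\<in>{..<N} - {n}. (1 / 4 :: real) ^ ((n - m) + (m - n)))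
    \<le> (\<Sum>m\<in>{..<n} \<union> {Suc n..<N}. (1 / 4) ^ ((n - m) + (m - n)))"
    by (intro sum_mono2) auto
  also have "\<dots> = (\<Sum>m<n. (1 / 4) ^ ((n - m) + (m - n))) + (\<Sum>m\<in>{Suc n..<N}. (1 / 4) ^ ((n - m) + (m - n)))"
    by (intro sum.union_disjoint) auto
  also have "(\<Sum>m<n. (1 / 4 :: real) ^ ((n - m) + (m - n))) = (\<Sum>m<n. (1 / 4) * (1 / 4) ^ (n - Suc m))"
    by (intro sum.cong) (auto simp flip: power_Suc simp: Suc_diff_Suc)
  also have "\<dots> = 1 / 4 * (\<Sum>m<n. (1 / 4) ^ m)"
    by (simp only: sum_distrib_left[symmetric] sum.nat_diff_reindex)
  also have "(\<Sum>m\<in>{Suc n..<N}. (1 / 4 :: real) ^ ((n - m) + (m - n))) = (\<Sum>j<N - Suc n. (1 / 4) * (1 / 4) ^ j)"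
    by (subst sum.atLeastLessThan_shift_0) (simp add: lessThan_atLeast0)
  also have "\<dots> = 1 / 4 * (\<Sum>j<N - Suc n. (1 / 4) ^ j)"
    by (simp only: sum_distrib_left)
  finally show ?thesis
    using geometric_sum_quarter_le[of n] geometric_sum_quarter_le[of "N - Suc n"] by linarith
qed

text \<open>Here (1 + 2t) (1 - t) >= 1 and 1 + 2t <= exp (2t). Exponential bounds turn the product
  of Lagrange factors into a sum of exponents.\<close>

lemma inverse_one_minus_le_exp:
  fixes t :: real
  assumes "0 \<le> t" "t \<le> 1 / 4"
  shows "1 / (1 - t) \<le> exp (2 * t)"
proof -
  have "1 \<le> (1 + 2 * t) * (1 - t)"
  proof -
    have "t * t \<le> t * (1 / 2)" using assms by (intro mult_left_mono) auto
    then show ?thesis by (simp add: algebra_simps)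
  qed
  also have "\<dots> \<le> exp (2 * t) * (1 - t)"
    using assms by (intro mult_right_mono exp_ge_add_one_self) auto
  finally show ?thesis using assms by (simp add: field_simps)
qed

text \<open>The denominator has modulus max (4^m) (4^n) (1 - t) with t = 4^(-|n-m|), and the
  numerator is at most 4^m (1 + R 4^(-m)). The quotient of the leading powers is (1/4)^(n - m),
  where truncated subtraction yields 1 for m > n.\<close>

lemma lagrange_factor_le:
  assumes "m \<noteq> n" "cmod y \<le> R"
  shows "cmod ((y - complex_of_real (4 ^ m)) / (complex_of_real (4 ^ n) - complex_of_real (4 ^ m)))
    \<le> exp (R * (1 / 4) ^ m + 2 * (1 / 4) ^ ((n - m) + (m - n))) * (1 / 4) ^ (n - m)"
proof -
  define t :: real where "t = (1 / 4) ^ ((n - m) + (m - n))"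
  define u :: real where "u = (1 / 4) ^ (n - m)"
  have "t \<le> (1 / 4) ^ 1"
    unfolding t_def using assms(1) by (intro power_decreasing) auto
  then have t: "0 \<le> t" "t \<le> 1 / 4" by (auto simp: t_def)
  have u: "u > 0" by (simp add: u_def)
  have den: "cmod (complex_of_real (4 ^ n) - complex_of_real (4 ^ m)) = 4 ^ m * (1 - t) / u"
  proof -
    have "cmod (complex_of_real (4 ^ n) - complex_of_real (4 ^ m)) = \<bar>4 ^ n - 4 ^ m\<bar>"
      by (simp only: norm_of_real flip: of_real_diff)
    also have "\<dots> = 4 ^ m * (1 - t) / u"
    proof (cases "m < n")
      case True
      then obtain k where k: "n = m + k" using less_imp_add_positive by blast
      then have tu: "t = 1 / 4 ^ k" "u = 1 / 4 ^ k" by (simp_all add: t_def u_def power_one_over)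
      have "(4::real) ^ n \<ge> 4 ^ m" using True by (intro power_increasing) auto
      then have "\<bar>4 ^ n - 4 ^ m\<bar> = (4::real) ^ n - 4 ^ m" by simp
      also have "\<dots> = 4 ^ m * (4 ^ k - 1)" using k by (simp add: power_add algebra_simps)
      also have "\<dots> = 4 ^ m * (1 - t) / u" by (simp add: tu field_simps)
      finally show ?thesis .
    next
      case False
      then obtain k where k: "m = n + k" using assms(1) le_Suc_ex[of n m] by auto
      then have tu: "t = 1 / 4 ^ k" "u = 1" by (simp_all add: t_def u_def power_one_over)
      have "(4::real) ^ n \<le> 4 ^ m" using False by (intro power_increasing) auto
      then have "\<bar>4 ^ n - 4 ^ m\<bar> = (4::real) ^ m - 4 ^ n" by simp
      also have "\<dots> = 4 ^ m * (1 - t) / u" using k by (simp add: tu power_add field_simps)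
      finally show ?thesis .
    qed
    finally show ?thesis .
  qed
  have "cmod (y - complex_of_real (4 ^ m)) \<le> R + 4 ^ m"
    using norm_triangle_ineq4[of y "complex_of_real (4 ^ m)"] assms(2) by (simp add: norm_power)
  also have "\<dots> = 4 ^ m * (1 + R * (1 / 4) ^ m)"
    by (simp add: power_one_over field_simps)
  also have "\<dots> \<le> 4 ^ m * exp (R * (1 / 4) ^ m)"
    by (intro mult_left_mono exp_ge_add_one_self) auto
  finally have num: "cmod (y - complex_of_real (4 ^ m)) \<le> 4 ^ m * exp (R * (1 / 4) ^ m)" .
  have "cmod ((y - complex_of_real (4 ^ m)) / (complex_of_real (4 ^ n) - complex_of_real (4 ^ m)))
    \<le> 4 ^ m * exp (R * (1 / 4) ^ m) / (4 ^ m * (1 - t) / u)"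
    unfolding norm_divide den using t u by (intro divide_right_mono num) auto
  also have "\<dots> = exp (R * (1 / 4) ^ m) * (1 / (1 - t)) * u"
    using t u by (simp add: field_simps)
  also have "\<dots> \<le> exp (R * (1 / 4) ^ m) * exp (2 * t) * u"
    using u by (intro mult_right_mono mult_left_mono inverse_one_minus_le_exp t) auto
  finally show ?thesis by (simp add: exp_add t_def u_def)
qed

text \<open>Both exponents are summable geometrically in m, with total at most 2R + 2 for every N.
  Only nodes with m < n contribute powers of 1/4.\<close>

lemma lagrange_product_le:
  assumes "cmod y \<le> R" "n < N"
  shows "cmod (\<Prod>m\<in>{..<N} - {n}. (y - complex_of_real (4 ^ m)) / (complex_of_real (4 ^ n) - complex_of_real (4 ^ m)))
    \<le> exp (2 * R + 2) * (1 / 4) ^ (\<Sum>m<n. n - m)"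
proof -
  have R: "R \<ge> 0" using order_trans[OF norm_ge_zero assms(1)] .
  let ?A = "{..<N} - {n}"
  have "cmod (\<Prod>m\<in>?A. (y - complex_of_real (4 ^ m)) / (complex_of_real (4 ^ n) - complex_of_real (4 ^ m)))
    \<le> (\<Prod>m\<in>?A. exp (R * (1 / 4) ^ m + 2 * (1 / 4) ^ ((n - m) + (m - n))) * (1 / 4) ^ (n - m))"
    unfolding prod_norm[symmetric] using assms(1) by (intro prod_mono conjI lagrange_factor_le) auto
  also have "\<dots> = exp (\<Sum>m\<in>?A. R * (1 / 4) ^ m + 2 * (1 / 4) ^ ((n - m) + (m - n))) * (1 / 4) ^ (\<Sum>m\<in>?A. n - m)"
    by (simp add: prod.distrib exp_sum power_sum)
  also have "(\<Sum>m\<in>?A. n - m) = (\<Sum>m<n. n - m)"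
    using assms(2) by (intro sum.mono_neutral_right) auto
  also have "exp (\<Sum>m\<in>?A. R * (1 / 4) ^ m + 2 * (1 / 4) ^ ((n - m) + (m - n))) \<le> exp (2 * R + 2)"
  proof -
    have "(\<Sum>m\<in>?A. (1 / 4 :: real) ^ m) \<le> (\<Sum>m<N. (1 / 4) ^ m)"
      by (intro sum_mono2) auto
    also have "\<dots> \<le> 2" using geometric_sum_quarter_le[of N] by simp
    finally have "R * (\<Sum>m\<in>?A. (1 / 4 :: real) ^ m) \<le> R * 2" using R by (intro mult_left_mono)
    then show ?thesis
      using sum_quarter_dist_le[where N = N and n = n] by (simp add: sum.distrib flip: sum_distrib_left)
  qed
  finally show ?thesis by simp
qed

text \<open>Interpolation at as many nodes as the degree demands. A single term of the series for
  W^2 controls p at 4^n; times the Lagrange coefficient it leaves W 2^(-n) up to a constant, so the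
  bound is independent of the degree.\<close>

lemma geo_measure_evaluation_bound:
  fixes p :: "complex poly"
  defines "W \<equiv> L2_norm (power_density (\<i> / 2) 1 geo_measure) (rpoly p)"
  assumes y: "cmod y \<le> R"
  shows "cmod (poly p y) \<le> 2 * exp (2 * R + 2) * W"
proof -
  have meas: "rpoly p \<in> borel_measurable geo_measure"
    by (rule L2_measurable[OF has_all_moments_L2[OF has_all_moments_geo_measure]])
  have "(\<lambda>x. rpoly p x * (complex_of_real x - \<i> / 2) ^ 1) = rpoly (p * [:- \<i> / 2, 1:])"
    by (simp add: algebra_simps)
  then have W: "W = L2_norm geo_measure (rpoly (p * [:- \<i> / 2, 1:]))"
    unfolding W_def by (subst L2_norm_power_density[OF sets_geo_measure meas]) simp
  have W0: "W \<ge> 0" by (simp add: W_def)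
  have node: "cmod (rpoly p (4 ^ n)) * (1 / 4) ^ (\<Sum>m<n. n - m) \<le> W * (1 / 2) ^ n" for n
  proof (rule power2_le_imp_le)
    define a where "a = (cmod (rpoly p (4 ^ n)))\<^sup>2"
    have single: "(\<Sum>k\<in>{n}. geo_weight k * (cmod (rpoly (p * [:- \<i> / 2, 1:]) (4 ^ k)))\<^sup>2) \<le> W\<^sup>2"
      unfolding W sums_unique[OF geo_measure_sums_sq]
      by (intro sum_le_suminf sums_summable[OF geo_measure_sums_sq]) auto
    \<comment> \<open>The squared distance from 4^n to i/2 is 4^(2n) + 1/4, so the factor x - i/2
      cancels the 2n in the exponent n (n + 2) of the weight.\<close>
    have "(cmod (complex_of_real (4 ^ n) - \<i> / 2))\<^sup>2 \<ge> (4 ^ n)\<^sup>2"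
      by (simp add: cmod_power2)
    then have "a * (4 ^ n)\<^sup>2 \<le> a * (cmod (complex_of_real (4 ^ n) - \<i> / 2))\<^sup>2"
      by (intro mult_left_mono) (auto simp: a_def)
    moreover have "rpoly (p * [:- \<i> / 2, 1:]) (4 ^ n) = rpoly p (4 ^ n) * (complex_of_real (4 ^ n) - \<i> / 2)"
      by (simp add: algebra_simps)
    then have "(cmod (rpoly (p * [:- \<i> / 2, 1:]) (4 ^ n)))\<^sup>2 = a * (cmod (complex_of_real (4 ^ n) - \<i> / 2))\<^sup>2"
      by (simp only: norm_mult power_mult_distrib a_def)
    ultimately have "geo_weight n * (a * (4 ^ n)\<^sup>2) \<le> geo_weight n * (cmod (rpoly (p * [:- \<i> / 2, 1:]) (4 ^ n)))\<^sup>2"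
      by (simp only: geo_weight_nonneg mult_left_mono)
    also have "\<dots> \<le> W\<^sup>2" using single by simp
    finally have le: "geo_weight n * (a * (4 ^ n)\<^sup>2) \<le> W\<^sup>2" .
    have "geo_weight n * (a * (4 ^ n)\<^sup>2) = a * (1 / 4) ^ (n * n)"
    proof -
      have "n * (n + 2) = n * n + 2 * n" by (simp add: algebra_simps)
      then show ?thesis
        unfolding geo_weight_def by (simp only: power_add) (simp add: power_one_over mult.commute flip: power_mult)
    qed
    with le have "a * (1 / 4) ^ (n * n) * (1 / 4) ^ n \<le> W\<^sup>2 * (1 / 4) ^ n"
      by (intro mult_right_mono) auto
    moreover have "(cmod (rpoly p (4 ^ n)) * (1 / 4) ^ (\<Sum>m<n. n - m))\<^sup>2 = a * (1 / 4) ^ (n * n) * (1 / 4) ^ n"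
    proof -
      have "((1 / 4 :: real) ^ (\<Sum>m<n. n - m))\<^sup>2 = (1 / 4) ^ (n * (n + 1))"
        by (simp only: power_mult[symmetric] double_sum_diff[symmetric] mult.commute)
      then show ?thesis by (simp add: a_def power_mult_distrib power_add)
    qed
    moreover have "((1 / 2 :: real) ^ n)\<^sup>2 = (1 / 4) ^ n"
      by (simp add: power2_eq_square flip: power_mult_distrib)
    then have "(W * (1 / 2) ^ n)\<^sup>2 = W\<^sup>2 * (1 / 4) ^ n"
      by (simp only: power_mult_distrib)
    ultimately show "(cmod (rpoly p (4 ^ n)) * (1 / 4) ^ (\<Sum>m<n. n - m))\<^sup>2 \<le> (W * (1 / 2) ^ n)\<^sup>2"
      by simp
  qed (use W0 in auto)
  define N where "N = Suc (degree p)"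
  let ?L = "\<lambda>n. \<Prod>m\<in>{..<N} - {n}. (y - complex_of_real (4 ^ m)) / (complex_of_real (4 ^ n) - complex_of_real (4 ^ m))"
  have "poly p y = (\<Sum>n<N. rpoly p (4 ^ n) * ?L n)"
  proof (rule lagrange_interpolation)
    show "inj_on (\<lambda>n. complex_of_real (4 ^ n)) {..<N}"
      by (intro inj_onI) (simp only: of_real_eq_iff, simp)
  qed (simp_all add: N_def)
  then have "cmod (poly p y) \<le> (\<Sum>n<N. cmod (rpoly p (4 ^ n) * ?L n))"
    by (simp only: norm_sum)
  also have "\<dots> \<le> (\<Sum>n<N. exp (2 * R + 2) * (W * (1 / 2) ^ n))"
  proof (rule sum_mono)
    fix n assume "n \<in> {..<N}"
    then have "cmod (?L n) \<le> exp (2 * R + 2) * (1 / 4) ^ (\<Sum>m<n. n - m)"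
      by (intro lagrange_product_le[OF y]) simp
    then have "cmod (rpoly p (4 ^ n) * ?L n) \<le> cmod (rpoly p (4 ^ n)) * (exp (2 * R + 2) * (1 / 4) ^ (\<Sum>m<n. n - m))"
      unfolding norm_mult by (intro mult_left_mono) auto
    also have "\<dots> \<le> exp (2 * R + 2) * (W * (1 / 2) ^ n)"
      using mult_left_mono[OF node[of n], of "exp (2 * R + 2)"] by (simp add: mult_ac)
    finally show "cmod (rpoly p (4 ^ n) * ?L n) \<le> exp (2 * R + 2) * (W * (1 / 2) ^ n)" .
  qed
  also have "\<dots> = exp (2 * R + 2) * W * (\<Sum>n<N. (1 / 2) ^ n)"
    by (simp only: sum_distrib_left mult.assoc)
  also have "exp (2 * R + 2) * W * (\<Sum>n<N. (1 / 2) ^ n) \<le> exp (2 * R + 2) * W * 2"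
  proof (intro mult_left_mono)
    show "(\<Sum>n<N. (1 / 2 :: real) ^ n) \<le> 2" by (subst sum_gp_strict) simp
  qed (use W0 in auto)
  finally show ?thesis by (simp only: mult_ac)
qed

text \<open>For the measure |x - i/2|^2 times \<open>geo_measure\<close>, evaluations are bounded on
  every disc, so \<open>poly_sequence_null\<close> applies with the constant multiplier 1. The
  resulting closability descends to \<open>geo_measure\<close>.\<close>

lemma closable_geo_measure: "closable geo_measure moment_op"
proof (rule coeff_closable_imp_closable, rule coeff_closable_power_density[OF has_all_moments_geo_measure])
  let ?M = "power_density (\<i> / 2) 1 geo_measure"
  have M: "has_all_moments ?M"
    by (rule has_all_moments_power_density[OF has_all_moments_geo_measure])
  show "coeff_closable ?M"
    unfolding coeff_closable_def
  proof (intro allI impI, elim conjE)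
    fix Q :: "nat \<Rightarrow> complex poly" and e :: "nat \<Rightarrow> real" and h :: "real \<Rightarrow> complex"
    assume Q: "\<forall>n k. cmod (coeff (Q n) k) \<le> e n" and e: "e \<longlonglongrightarrow> 0" and h: "h \<in> L2 ?M"
      and lim: "(\<lambda>n. L2_norm ?M (\<lambda>x. rpoly (Q n) x - h x)) \<longlonglongrightarrow> 0"
    have "(\<lambda>n. rpoly (Q n) x) \<longlonglongrightarrow> 0" for x
    proof -
      \<comment> \<open>The disc of this radius about the origin contains x and meets the unit
        disc.\<close>
      define R where "R = \<bar>x\<bar> + 1"
      have "(\<lambda>n. rpoly (Q n) x * 1) \<longlonglongrightarrow> 0"
      proof (rule poly_sequence_null[where S = "ball 0 R" and g = "\<lambda>_. 1", OF M _ _ _ _ _ _ e h lim])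
        have "0 \<in> ball 0 R \<inter> ball (0 :: complex) 1" by (simp add: R_def)
        then show "ball 0 R \<inter> ball (0 :: complex) 1 \<noteq> {}" by blast
        show "cmod (poly p z * 1) \<le> 2 * exp (2 * R + 2) * L2_norm ?M (rpoly p)"
          if "z \<in> ball 0 R" for p z
          using geo_measure_evaluation_bound[of z R p] that by simp
        show "complex_of_real x \<in> ball 0 R" by (simp add: R_def)
      qed (use Q in auto)
      then show ?thesis by simp
    qed
    then show "AE x in ?M. h x = 0"
      by (intro L2_limit_zero_AE[OF has_all_moments_L2[OF M] h lim]) auto
  qed
qed (auto simp: norm_divide)

theorem theorem1p4:
  "(\<exists>M :: real measure. determinate M \<and> \<not> bounded (supp M) \<and> closable M moment_op) \<and>
   (\<forall>M :: real measure. determinate M \<and> index_of_determinacy M < \<infinity> \<longrightarrow> closable M moment_op)"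
  using determinate_geo_measure unbounded_supp_geo_measure closable_geo_measure
    finite_index_of_determinacy_imp_closable by blast

end
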